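(* Let $n$ be even, and let $\Omega$ be a relatively compact domain with smooth strictly convex boundary $M$ in an oriented locally flat projective manifold $N$ of dimension $n+1$. If $1\le m\le n/2$, then the conformal Codazzi GJMS operator $P_m:\mathcal{E}[m-n/2]\to\mathcal{E}[-m-n/2]$ on $M$ is independent of the choice of a Fefferman defining density $\boldsymbol\rho$ of $\Omega$.
   Context: **Projective densities.** $N$ is an oriented smooth manifold of dimension $n+1$ with a locally flat projective structure $[\nabla]$ (a class of torsion-free affine connections having the same unparametrized geodesics). $\mathcal{E}(w)=(\wedge^{n+1}T^*N)^{-w/(n+2)}$ is the projective density bundle of weight $w$; the same symbol denotes its smooth sections. A projective scale is a positive section $\tau\in\mathcal{E}(1)$; it determines the unique $\nabla\in[\nabla]$ with $\nabla\tau=0$. Only such connections are used. $P_{ij}=\frac1n\mathrm{Ric}_{ij}$ is the projective Schouten tensor of $\nabla$. Locally flat means that near each point there is an affine scale, i.e. a projective scale whose connection is flat. **Ambient space.** $\widetilde N$ is the $\mathbb{R}_+$-bundle over $N$ of positive elements of $\mathcal{E}(-1)$. A density $f\in\mathcal{E}(w)$ is identified with the function $v\mapsto f v^{w}$ on $\widetilde N$, homogeneous of degree $w$. A scale $\tau$ gives the fibre coordinate $t\in\mathbb{R}_+$ on $\widetilde N$ by $v=t\,\tau^{-1}$. $\widetilde N$ carries a canonical flat connection $D_I$: for a local affine scale $\tau$ and affine coordinates $x^i$ with $\tau^{-(n+2)}=dx^1\wedge\dots\wedge dx^{n+1}$, the functions $\xi^0=t$, $\xi^i=t x^i$ are affine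 coordinates, $D_I=\partial/\partial\xi^I$. For $\boldsymbol\rho\in\mathcal{E}(2)$ set $\mathcal{J}[\boldsymbol\rho]=\det(D_ID_J\boldsymbol\rho)$ (determinant in the coordinates $\xi^I$); in an arbitrary projective scale this is the determinant of $\begin{pmatrix}2\boldsymbol\rho&\nabla_j\boldsymbol\rho\\ \nabla_i\boldsymbol\rho&\nabla_i\nabla_j\boldsymbol\rho+2\boldsymbol\rho P_{ij}\end{pmatrix}$, a function on $N$ via $(\wedge^{n+1}T^*N)^{2}=\mathcal{E}(-2n-4)$. **Strictly convex domains.** For a relatively compact domain $\Omega\subset N$ with smooth boundary $M$, $M$ is strictly convex if $\nabla_i\nabla_j\rho|_{TM}$ is positive definite for a (equivalently any) $\nabla\in[\nabla]$ and a (any) defining function $\rho$ negative in $\Omega$. A defining density is $\boldsymbol\rho\in\mathcal{E}(2)$ such that $\tau^{-2}\boldsymbol\rho$ is a smooth defining function of $\Omega=\{\boldsymbol\rho<0\}$. $O(\boldsymbol\rho^k)$ denotes a term bounded by a constant times $|\boldsymbol\rho|^k$ near $M$ after trivializing densities by a projective scale on $N$. For $n$ even, a Fefferman defining density is a defining density with $\mathcal{J}[\boldsymbol\rho]=-1+\mathcal{O}\boldsymbol\rho^{n/2+1}$, $\mathcal{O}\in\mathcal{E}(-n-2)$ smooth. It is known that such $\boldsymbol\rho$ exists and is unique modulo $O(\boldsymbol\rho^{n/2+2})$. Its ambient metric is $\widetilde g_{IJ}=D_ID_J\boldsymbol\rho$, a Lorentz metric on $\widetilde N$ near $M$, with Levi-Civita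 connection $\widetilde\nabla$ and Laplacian $\widetilde\Delta=-\widetilde g^{IJ}\widetilde\nabla_I\widetilde\nabla_J$. **Conformal densities on $M$.** Given a scale $\tau$ with connection $\nabla$, the affine normal field $\xi$ is the unique transverse vector field along $M$ with $d\rho(\xi)>0$ such that $\nabla_XY=\nabla^\xi_XY-h(X,Y)\xi$ and $\nabla_X\xi\in TM$ for $X,Y$ tangent to $M$ (with $\nabla^\xi_XY$ tangent to $M$), and such that the Riemannian metric $h$ (the affine metric) satisfies $(\xi\lrcorner\,\tau^{-(n+2)})|_{TM}=vol_h$. $\mathcal{E}[w]=(\wedge^nT^*M)^{-w/n}$, and $\mathcal{E}(w)|_M$ is identified with $\mathcal{E}[w]$ via $\tau|_M\mapsto(vol_h)^{-1/n}$. **GJMS operator.** For a positive integer $m$ and $f\in\mathcal{E}[m-n/2]$, $P_mf=\widetilde\Delta^m\widetilde f\,|_M$, where $\widetilde f\in\mathcal{E}(m-n/2)$ is any smooth extension of $f$ (the result does not depend on the extension). *)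

theory Defs
  imports "HOL-Analysis.Analysis"
begin

section \<open>Calculus in coordinates\<close>

definition pd :: "'k::finite \<Rightarrow> (real^'k \<Rightarrow> 'b::real_normed_vector) \<Rightarrow> real^'k \<Rightarrow> 'b" where
  "pd i f x = frechet_derivative f (at x) (axis i 1)"

fun Ck_on :: "nat \<Rightarrow> 'v::real_normed_vector set \<Rightarrow> ('v \<Rightarrow> 'b::real_normed_vector) \<Rightarrow> bool" where
  "Ck_on 0 S f \<longleftrightarrow> continuous_on S f"
| "Ck_on (Suc k) S f \<longleftrightarrow> (\<forall>x\<in>S. f differentiable (at x))
     \<and> (\<forall>v. Ck_on k S (\<lambda>x. frechet_derivative f (at x) v))"

text \<open>Only used for open \<open>S\<close>.\<close>

definition smooth_on :: "'v::real_normed_vector set \<Rightarrow> ('v \<Rightarrow> 'b::real_normed_vector) \<Rightarrow> bool" where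
  "smooth_on S f \<longleftrightarrow> (\<forall>k. Ck_on k S f)"

section \<open>Oriented manifolds and densities\<close>

text \<open>A chart is a pair of its domain and its coordinate map; the values of the coordinate map
  outside the domain are irrelevant.\<close>

type_synonym ('a, 'd) chart = "'a set \<times> ('a \<Rightarrow> real^'d)"

abbreviation cinv :: "('a, 'd) chart \<Rightarrow> real^'d \<Rightarrow> 'a" where
  "cinv c \<equiv> inv_into (fst c) (snd c)"

definition is_chart :: "'a::topological_space set \<Rightarrow> ('a, 'd::finite) chart \<Rightarrow> bool" where
  "is_chart X c \<longleftrightarrow> openin (top_of_set X) (fst c) \<and> open (snd c ` fst c)
     \<and> homeomorphism (fst c) (snd c ` fst c) (snd c) (cinv c)"

definition transition :: "('a, 'd::finite) chart \<Rightarrow> ('a, 'd) chart \<Rightarrow> real^'d \<Rightarrow> real^'d" where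
  "transition c c' = snd c' \<circ> cinv c"

definition jacobian :: "('a, 'd::finite) chart \<Rightarrow> ('a, 'd) chart \<Rightarrow> 'a \<Rightarrow> real^'d^'d" where
  "jacobian c c' p = (\<chi> a i. pd i (transition c c') (snd c p) $ a)"

definition oriented_compatible :: "('a, 'd::finite) chart \<Rightarrow> ('a, 'd) chart \<Rightarrow> bool" where
  "oriented_compatible c c' \<longleftrightarrow> smooth_on (snd c ` (fst c \<inter> fst c')) (transition c c')
     \<and> (\<forall>p \<in> fst c \<inter> fst c'. 0 < det (jacobian c c' p))"

text \<open>Smooth structure together with orientation: a maximal oriented atlas.  The Hausdorff and
  second countability axioms are imposed through the type class of the points.\<close>

definition oriented_atlas ::
    "'a::{t2_space, second_countable_topology} set \<Rightarrow> ('a, 'd::finite) chart set \<Rightarrow> bool" where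
  "oriented_atlas X A \<longleftrightarrow> (\<forall>c\<in>A. is_chart X c) \<and> (\<Union>c\<in>A. fst c) = X
     \<and> (\<forall>c\<in>A. \<forall>c'\<in>A. oriented_compatible c c')
     \<and> (\<forall>c. is_chart X c \<and> (\<forall>c'\<in>A. oriented_compatible c c' \<and> oriented_compatible c' c)
            \<longrightarrow> c \<in> A)"

definition smooth_fun :: "('a, 'd::finite) chart set \<Rightarrow> ('a \<Rightarrow> real) \<Rightarrow> bool" where
  "smooth_fun A r \<longleftrightarrow> (\<forall>c\<in>A. smooth_on (snd c ` fst c) (r \<circ> cinv c))"

text \<open>Smooth sections over an open set \<open>W\<close> of the \<open>s\<close>-th power of the line bundle of
  top-degree forms.  A section \<open>f\<close> is given by its components: on the domain of \<open>c\<close> it is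
  \<open>f c (dx\<^sup>1 \<and> \<dots> \<and> dx\<^sup>d)\<^sup>s\<close> in the coordinates of \<open>c\<close>.\<close>

type_synonym ('a, 'd) components = "('a, 'd) chart \<Rightarrow> 'a \<Rightarrow> real"

definition volume_power_section ::
    "('a, 'd::finite) chart set \<Rightarrow> 'a set \<Rightarrow> real \<Rightarrow> ('a, 'd) components \<Rightarrow> bool" where
  "volume_power_section A W s f \<longleftrightarrow>
     (\<forall>c\<in>A. smooth_on (snd c ` (fst c \<inter> W)) (f c \<circ> cinv c))
   \<and> (\<forall>c\<in>A. \<forall>c'\<in>A. \<forall>p \<in> fst c \<inter> fst c' \<inter> W.
        f c p = det (jacobian c c' p) powr s * f c' p)"

section \<open>Connections and projective structures\<close>

text \<open>\<open>\<Gamma> c p k i j\<close> is the Christoffel symbol with upper index \<open>k\<close> and lower indices \<open>i\<close>, \<open>j\<close>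
  at \<open>p\<close> in the chart \<open>c\<close>.\<close>

type_synonym ('a, 'd) conn = "('a, 'd) chart \<Rightarrow> 'a \<Rightarrow> 'd \<Rightarrow> 'd \<Rightarrow> 'd \<Rightarrow> real"

definition torsion_free_connection ::
    "('a, 'd::finite) chart set \<Rightarrow> 'a set \<Rightarrow> ('a, 'd) conn \<Rightarrow> bool" where
  "torsion_free_connection A W \<Gamma> \<longleftrightarrow>
     (\<forall>c\<in>A. \<forall>k i j. smooth_on (snd c ` (fst c \<inter> W)) (\<lambda>x. \<Gamma> c (cinv c x) k i j))
   \<and> (\<forall>c\<in>A. \<forall>p \<in> fst c \<inter> W. \<forall>k i j. \<Gamma> c p k i j = \<Gamma> c p k j i)
   \<and> (\<forall>c\<in>A. \<forall>c'\<in>A. \<forall>p \<in> fst c \<inter> fst c' \<inter> W. \<forall>a i j.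
        (\<Sum>k\<in>UNIV. jacobian c c' p $ a $ k * \<Gamma> c p k i j)
        = pd i (pd j (transition c c')) (snd c p) $ a
          + (\<Sum>b\<in>UNIV. \<Sum>e\<in>UNIV. \<Gamma> c' p a b e * jacobian c c' p $ b $ i * jacobian c c' p $ e $ j))"

definition christoffel_apply ::
    "('a, 'd::finite) conn \<Rightarrow> ('a, 'd) chart \<Rightarrow> 'a \<Rightarrow> real^'d \<Rightarrow> real^'d \<Rightarrow> real^'d" where
  "christoffel_apply \<Gamma> c p u v = (\<chi> k. \<Sum>i\<in>UNIV. \<Sum>j\<in>UNIV. \<Gamma> c p k i j * u $ i * v $ j)"

definition open_interval :: "real set \<Rightarrow> bool" where
  "open_interval I \<longleftrightarrow> open I \<and> is_interval I \<and> I \<noteq> {}"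

definition geodesic ::
    "('a::topological_space, 'd::finite) chart set \<Rightarrow> 'a set \<Rightarrow> ('a, 'd) conn \<Rightarrow> real set
      \<Rightarrow> (real \<Rightarrow> 'a) \<Rightarrow> bool" where
  "geodesic A W \<Gamma> I \<gamma> \<longleftrightarrow> open_interval I \<and> continuous_on I \<gamma> \<and> \<gamma> ` I \<subseteq> W
     \<and> (\<forall>c\<in>A. smooth_on {s\<in>I. \<gamma> s \<in> fst c} (snd c \<circ> \<gamma>))
     \<and> (\<forall>c\<in>A. \<forall>s\<in>I. \<gamma> s \<in> fst c \<longrightarrow>
          (let u = (\<lambda>s. vector_derivative (snd c \<circ> \<gamma>) (at s)) in
           vector_derivative u (at s) + christoffel_apply \<Gamma> c (\<gamma> s) (u s) (u s) = 0))"

text \<open>A curve which becomes a geodesic after a change of parameter.\<close>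

definition unparametrized_geodesic ::
    "('a::topological_space, 'd::finite) chart set \<Rightarrow> 'a set \<Rightarrow> ('a, 'd) conn \<Rightarrow> real set
      \<Rightarrow> (real \<Rightarrow> 'a) \<Rightarrow> bool" where
  "unparametrized_geodesic A W \<Gamma> I \<gamma> \<longleftrightarrow> open_interval I
     \<and> (\<exists>J h. open_interval J \<and> smooth_on J h \<and> bij_betw h J I \<and> (\<forall>s\<in>J. deriv h s \<noteq> 0)
          \<and> geodesic A W \<Gamma> J (\<gamma> \<circ> h))"

definition projectively_equivalent ::
    "('a::topological_space, 'd::finite) chart set \<Rightarrow> 'a set \<Rightarrow> ('a, 'd) conn \<Rightarrow> ('a, 'd) conn
      \<Rightarrow> bool" where
  "projectively_equivalent A W \<Gamma> \<Gamma>' \<longleftrightarrow>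
     (\<forall>I \<gamma>. unparametrized_geodesic A W \<Gamma> I \<gamma> \<longleftrightarrow> unparametrized_geodesic A W \<Gamma>' I \<gamma>)"

text \<open>With \<open>n = CARD('n)\<close>, the manifold has dimension \<open>n + 1 = CARD('n option)\<close>, the ambient
  space has dimension \<open>n + 2 = CARD('n option option)\<close>, and hypersurfaces have charts in
  \<open>real^'n\<close>.\<close>

record ('a, 'n) proj_mfd =
  pts :: "'a set"
  atl :: "('a, 'n option) chart set"
  pcls :: "('a, 'n option) conn set"

definition oriented_projective_manifold ::
    "('a::{t2_space, second_countable_topology}, 'n::finite) proj_mfd \<Rightarrow> bool" where
  "oriented_projective_manifold N \<longleftrightarrow> oriented_atlas (pts N) (atl N)
     \<and> (\<exists>\<Gamma>0. torsion_free_connection (atl N) (pts N) \<Gamma>0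
          \<and> pcls N = {\<Gamma>. torsion_free_connection (atl N) (pts N) \<Gamma>
                        \<and> projectively_equivalent (atl N) (pts N) \<Gamma> \<Gamma>0})"

text \<open>The projective class induced on an open subset \<open>W\<close>.\<close>

definition pcls_on ::
    "('a::topological_space, 'n::finite) proj_mfd \<Rightarrow> 'a set \<Rightarrow> ('a, 'n option) conn set" where
  "pcls_on N W = {\<Gamma>. torsion_free_connection (atl N) W \<Gamma>
                   \<and> (\<exists>\<Gamma>0\<in>pcls N. projectively_equivalent (atl N) W \<Gamma> \<Gamma>0)}"

text \<open>\<open>\<E>(w)\<close> over an open set \<open>W\<close>.\<close>

definition proj_density ::
    "('a, 'n::finite) proj_mfd \<Rightarrow> 'a set \<Rightarrow> real \<Rightarrow> ('a, 'n option) components \<Rightarrow> bool" where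
  "proj_density N W w f \<longleftrightarrow> volume_power_section (atl N) W (- w / (real CARD('n) + 2)) f"

definition proj_scale ::
    "('a, 'n::finite) proj_mfd \<Rightarrow> 'a set \<Rightarrow> ('a, 'n option) components \<Rightarrow> bool" where
  "proj_scale N W \<tau> \<longleftrightarrow> proj_density N W 1 \<tau> \<and> (\<forall>c\<in>atl N. \<forall>p \<in> fst c \<inter> W. 0 < \<tau> c p)"

text \<open>The connection \<open>\<nabla> \<in> [\<nabla>]\<close> with \<open>\<nabla>\<tau> = 0\<close>.  A component of a top-degree form satisfies
  \<open>\<nabla>\<^sub>i \<omega> = \<partial>\<^sub>i \<omega> - \<Gamma>\<^sup>k\<^sub>k\<^sub>i \<omega>\<close>, hence \<open>\<nabla>\<^sub>i \<tau> = \<partial>\<^sub>i \<tau> + \<Gamma>\<^sup>k\<^sub>k\<^sub>i \<tau> / (n + 2)\<close>.\<close>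

definition scale_connection ::
    "('a::topological_space, 'n::finite) proj_mfd \<Rightarrow> 'a set \<Rightarrow> ('a, 'n option) components
      \<Rightarrow> ('a, 'n option) conn \<Rightarrow> bool" where
  "scale_connection N W \<tau> \<Gamma> \<longleftrightarrow> \<Gamma> \<in> pcls_on N W
     \<and> (\<forall>c\<in>atl N. \<forall>p \<in> fst c \<inter> W. \<forall>i.
          pd i (\<tau> c \<circ> cinv c) (snd c p)
          + (\<Sum>k\<in>UNIV. \<Gamma> c p k k i) * \<tau> c p / (real CARD('n) + 2) = 0)"

definition flat_connection ::
    "('a, 'd::finite) chart set \<Rightarrow> 'a set \<Rightarrow> ('a, 'd) conn \<Rightarrow> bool" where
  "flat_connection A W \<Gamma> \<longleftrightarrow> (\<forall>c\<in>A. \<forall>p \<in> fst c \<inter> W. \<forall>i j k l.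
      pd i (\<lambda>x. \<Gamma> c (cinv c x) k j l) (snd c p) - pd j (\<lambda>x. \<Gamma> c (cinv c x) k i l) (snd c p)
      + (\<Sum>a\<in>UNIV. \<Gamma> c p k i a * \<Gamma> c p a j l - \<Gamma> c p k j a * \<Gamma> c p a i l) = 0)"

definition affine_scale ::
    "('a::topological_space, 'n::finite) proj_mfd \<Rightarrow> 'a set \<Rightarrow> ('a, 'n option) components
      \<Rightarrow> ('a, 'n option) conn \<Rightarrow> bool" where
  "affine_scale N W \<tau> \<Gamma> \<longleftrightarrow>
     proj_scale N W \<tau> \<and> scale_connection N W \<tau> \<Gamma> \<and> flat_connection (atl N) W \<Gamma>"

definition locally_flat :: "('a::topological_space, 'n::finite) proj_mfd \<Rightarrow> bool" where
  "locally_flat N \<longleftrightarrow>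
     (\<forall>p\<in>pts N. \<exists>W \<tau> \<Gamma>. openin (top_of_set (pts N)) W \<and> p \<in> W \<and> affine_scale N W \<tau> \<Gamma>)"

section \<open>Ambient space\<close>

text \<open>Affine coordinates of a local affine scale, normalized by
  \<open>\<tau>\<^sup>-\<^sup>(\<^sup>n\<^sup>+\<^sup>2\<^sup>) = dx\<^sup>1 \<and> \<dots> \<and> dx\<^sup>n\<^sup>+\<^sup>1\<close>, i.e. \<open>\<tau>\<close> has component \<open>1\<close>.\<close>

definition affine_chart ::
    "('a::topological_space, 'n::finite) proj_mfd \<Rightarrow> ('a, 'n option) chart \<Rightarrow> bool" where
  "affine_chart N c \<longleftrightarrow> c \<in> atl N
     \<and> (\<exists>\<tau> \<Gamma>. affine_scale N (fst c) \<tau> \<Gamma>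
           \<and> (\<forall>p\<in>fst c. \<tau> c p = 1 \<and> (\<forall>k i j. \<Gamma> c p k i j = 0)))"

text \<open>Over an affine chart, the element \<open>v = t \<tau>\<^sup>-\<^sup>1\<close> of the ambient space over the point with
  coordinates \<open>x\<close> has the affine coordinates \<open>\<xi>\<^sup>0 = t\<close> (index \<open>None\<close>) and
  \<open>\<xi>\<^sup>i = t x\<^sup>i\<close> (index \<open>Some i\<close>).  A density \<open>f\<close> of weight \<open>w\<close> is the function \<open>v \<mapsto> f v\<^sup>w\<close>
  there.\<close>

definition ambient_point ::
    "('a, 'n option) chart \<Rightarrow> real \<Rightarrow> 'a \<Rightarrow> real^('n::finite option option)" where
  "ambient_point c t p = (\<chi> I. case I of None \<Rightarrow> t | Some i \<Rightarrow> t * snd c p $ i)"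

definition ambient_fun ::
    "real \<Rightarrow> ('a, 'n::finite option) components \<Rightarrow> ('a, 'n option) chart
      \<Rightarrow> real^('n option option) \<Rightarrow> real" where
  "ambient_fun w f c \<xi> = f c (cinv c (\<chi> i. \<xi> $ Some i / \<xi> $ None)) * (\<xi> $ None) powr w"

definition hessian :: "(real^'k::finite \<Rightarrow> real) \<Rightarrow> real^'k \<Rightarrow> real^'k^'k" where
  "hessian F \<xi> = (\<chi> I J. pd I (pd J F) \<xi>)"

definition levi_civita :: "(real^'k::finite \<Rightarrow> real^'k^'k) \<Rightarrow> real^'k \<Rightarrow> 'k \<Rightarrow> 'k \<Rightarrow> 'k \<Rightarrow> real" where
  "levi_civita g \<xi> K I J = (\<Sum>L\<in>UNIV. matrix_inv (g \<xi>) $ K $ L *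
      (pd I (\<lambda>\<eta>. g \<eta> $ J $ L) \<xi> + pd J (\<lambda>\<eta>. g \<eta> $ I $ L) \<xi> - pd L (\<lambda>\<eta>. g \<eta> $ I $ J) \<xi>)) / 2"

text \<open>The sign convention is \<open>\<Delta> = - g\<^sup>I\<^sup>J \<nabla>\<^sub>I \<nabla>\<^sub>J\<close>.\<close>

definition laplacian ::
    "(real^'k::finite \<Rightarrow> real^'k^'k) \<Rightarrow> (real^'k \<Rightarrow> real) \<Rightarrow> real^'k \<Rightarrow> real" where
  "laplacian g F \<xi> = - (\<Sum>I\<in>UNIV. \<Sum>J\<in>UNIV. matrix_inv (g \<xi>) $ I $ J *
      (pd I (pd J F) \<xi> - (\<Sum>K\<in>UNIV. levi_civita g \<xi> K I J * pd K F \<xi>)))"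

definition ambient_metric ::
    "('a, 'n::finite option) components \<Rightarrow> ('a, 'n option) chart
      \<Rightarrow> real^('n option option) \<Rightarrow> real^('n option option)^('n option option)" where
  "ambient_metric \<rho> c = hessian (ambient_fun 2 \<rho> c)"

text \<open>\<open>\<J>[\<rho>]\<close> as a homogeneous function of degree \<open>0\<close> of the affine ambient coordinates.\<close>

definition calJ ::
    "('a, 'n::finite option) components \<Rightarrow> ('a, 'n option) chart \<Rightarrow> real^('n option option)
      \<Rightarrow> real" where
  "calJ \<rho> c \<xi> = det (hessian (ambient_fun 2 \<rho> c) \<xi>)"

section \<open>Strictly convex domains\<close>

definition bdry :: "('a::topological_space, 'n) proj_mfd \<Rightarrow> 'a set \<Rightarrow> 'a set" where
  "bdry N \<Omega> = pts N \<inter> closure \<Omega> - \<Omega>"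

definition defining_function ::
    "('a::topological_space, 'n::finite) proj_mfd \<Rightarrow> 'a set \<Rightarrow> ('a \<Rightarrow> real) \<Rightarrow> bool" where
  "defining_function N \<Omega> r \<longleftrightarrow> smooth_fun (atl N) r \<and> \<Omega> = {p\<in>pts N. r p < 0}
     \<and> (\<forall>c\<in>atl N. \<forall>p \<in> bdry N \<Omega> \<inter> fst c. \<exists>i. pd i (r \<circ> cinv c) (snd c p) \<noteq> 0)"

definition relatively_compact_domain ::
    "('a::topological_space, 'n) proj_mfd \<Rightarrow> 'a set \<Rightarrow> bool" where
  "relatively_compact_domain N \<Omega> \<longleftrightarrow> openin (top_of_set (pts N)) \<Omega> \<and> connected \<Omega> \<and> \<Omega> \<noteq> {}
     \<and> compact (pts N \<inter> closure \<Omega>)"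

definition smooth_strictly_convex_boundary ::
    "('a::topological_space, 'n::finite) proj_mfd \<Rightarrow> 'a set \<Rightarrow> bool" where
  "smooth_strictly_convex_boundary N \<Omega> \<longleftrightarrow>
     (\<exists>r \<Gamma>. defining_function N \<Omega> r \<and> \<Gamma> \<in> pcls N
       \<and> (\<forall>c\<in>atl N. \<forall>p \<in> bdry N \<Omega> \<inter> fst c. \<forall>v::real^'n option.
            v \<noteq> 0 \<and> (\<Sum>i\<in>UNIV. pd i (r \<circ> cinv c) (snd c p) * v $ i) = 0 \<longrightarrow>
            0 < (\<Sum>i\<in>UNIV. \<Sum>j\<in>UNIV. (pd i (pd j (r \<circ> cinv c)) (snd c p)
                   - (\<Sum>k\<in>UNIV. \<Gamma> c p k i j * pd k (r \<circ> cinv c) (snd c p))) * v $ i * v $ j)))"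

text \<open>\<open>\<rho> \<in> \<E>(2)\<close> such that \<open>\<tau>\<^sup>-\<^sup>2 \<rho>\<close> is a defining function.\<close>

definition defining_density ::
    "('a::topological_space, 'n::finite) proj_mfd \<Rightarrow> 'a set \<Rightarrow> ('a, 'n option) components \<Rightarrow> bool"
  where
  "defining_density N \<Omega> \<rho> \<longleftrightarrow> proj_density N (pts N) 2 \<rho>
     \<and> (\<exists>\<tau> r. proj_scale N (pts N) \<tau> \<and> defining_function N \<Omega> r
          \<and> (\<forall>c\<in>atl N. \<forall>p\<in>fst c. r p = \<tau> c p powr (- 2) * \<rho> c p))"

definition fefferman_defining_density ::
    "('a::topological_space, 'n::finite) proj_mfd \<Rightarrow> 'a set \<Rightarrow> ('a, 'n option) components \<Rightarrow> bool"
  where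
  "fefferman_defining_density N \<Omega> \<rho> \<longleftrightarrow> defining_density N \<Omega> \<rho>
     \<and> (\<exists>\<O>. proj_density N (pts N) (- (real CARD('n) + 2)) \<O>
          \<and> (\<forall>c. affine_chart N c \<longrightarrow> (\<forall>p\<in>fst c. \<forall>t>0.
               calJ \<rho> c (ambient_point c t p) = - 1 + \<O> c p * \<rho> c p ^ (CARD('n) div 2 + 1))))"

section \<open>Conformal densities on the boundary\<close>

text \<open>Coordinate vectors of a chart \<open>b\<close> of a hypersurface, in a chart \<open>c\<close> of the manifold.\<close>

definition tangent_vec ::
    "('a, 'n option) chart \<Rightarrow> ('a, 'n::finite) chart \<Rightarrow> 'a \<Rightarrow> 'n \<Rightarrow> real^'n option" where
  "tangent_vec c b p i = pd i (snd c \<circ> cinv b) (snd b p)"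

text \<open>The value of \<open>v \<lrcorner> (dx\<^sup>1 \<and> \<dots> \<and> dx\<^sup>n\<^sup>+\<^sup>1)\<close> on the coordinate frame of \<open>b\<close>.\<close>

definition contracted_volume ::
    "('a, 'n option) chart \<Rightarrow> ('a, 'n::finite) chart \<Rightarrow> 'a \<Rightarrow> real^'n option \<Rightarrow> real" where
  "contracted_volume c b p v =
     det (\<chi> a I. (case I of None \<Rightarrow> v | Some i \<Rightarrow> tangent_vec c b p i) $ a)"

definition outward ::
    "('a::topological_space, 'n::finite) proj_mfd \<Rightarrow> 'a set \<Rightarrow> ('a, 'n option) chart \<Rightarrow> 'a
      \<Rightarrow> real^'n option \<Rightarrow> bool" where
  "outward N \<Omega> c p v \<longleftrightarrow> (\<exists>r. defining_function N \<Omega> r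
     \<and> 0 < (\<Sum>i\<in>UNIV. pd i (r \<circ> cinv c) (snd c p) * v $ i))"

text \<open>Charts of \<open>M = \<partial>\<Omega>\<close> as a submanifold, oriented by outward transverse vectors (so that
  \<open>(\<xi> \<lrcorner> \<tau>\<^sup>-\<^sup>(\<^sup>n\<^sup>+\<^sup>2\<^sup>))|TM\<close> is positive).  Positivity of the determinant also makes the inverse of
  a chart an immersion.\<close>

definition bdry_atlas ::
    "('a::topological_space, 'n::finite) proj_mfd \<Rightarrow> 'a set \<Rightarrow> ('a, 'n) chart set" where
  "bdry_atlas N \<Omega> = {b. is_chart (bdry N \<Omega>) b
     \<and> (\<forall>c\<in>atl N. smooth_on (snd b ` (fst b \<inter> fst c)) (snd c \<circ> cinv b)
          \<and> (\<forall>p \<in> fst b \<inter> fst c. \<forall>v. outward N \<Omega> c p v \<longrightarrow> 0 < contracted_volume c b p v))}"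

text \<open>\<open>\<E>[w]\<close>\<close>

definition conf_density ::
    "('a::topological_space, 'n::finite) proj_mfd \<Rightarrow> 'a set \<Rightarrow> real \<Rightarrow> ('a, 'n) components \<Rightarrow> bool"
  where
  "conf_density N \<Omega> w f \<longleftrightarrow>
     volume_power_section (bdry_atlas N \<Omega>) (bdry N \<Omega>) (- w / real CARD('n)) f"

text \<open>\<open>\<xi>\<close> is the affine normal field and \<open>h\<close> the affine metric of the scale \<open>\<tau>\<close> with connection
  \<open>\<Gamma>\<close>; \<open>\<xi> c p\<close> and \<open>h b p\<close> are the components in a chart \<open>c\<close> of the manifold and a chart \<open>b\<close>
  of its boundary.\<close>

definition affine_normal ::
    "('a::topological_space, 'n::finite) proj_mfd \<Rightarrow> 'a set \<Rightarrow> ('a, 'n option) components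
      \<Rightarrow> ('a, 'n option) conn \<Rightarrow> (('a, 'n option) chart \<Rightarrow> 'a \<Rightarrow> real^'n option)
      \<Rightarrow> (('a, 'n) chart \<Rightarrow> 'a \<Rightarrow> real^'n^'n) \<Rightarrow> bool" where
  "affine_normal N \<Omega> \<tau> \<Gamma> \<xi> h \<longleftrightarrow>
     (\<forall>c\<in>atl N. \<forall>c'\<in>atl N. \<forall>p \<in> bdry N \<Omega> \<inter> fst c \<inter> fst c'. \<xi> c' p = jacobian c c' p *v \<xi> c p)
   \<and> (\<forall>c\<in>atl N. \<forall>p \<in> bdry N \<Omega> \<inter> fst c. outward N \<Omega> c p (\<xi> c p))
   \<and> (\<forall>b\<in>bdry_atlas N \<Omega>. \<forall>p\<in>fst b. \<forall>v. v \<noteq> 0 \<longrightarrow> 0 < v \<bullet> (h b p *v v))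
   \<and> (\<forall>c\<in>atl N. \<forall>b\<in>bdry_atlas N \<Omega>.
        smooth_on (snd b ` (fst b \<inter> fst c)) (\<xi> c \<circ> cinv b)
      \<and> (\<forall>p \<in> fst b \<inter> fst c. let e = tangent_vec c b p; T = span (range e) in
           (\<forall>i j. pd i (pd j (snd c \<circ> cinv b)) (snd b p) + christoffel_apply \<Gamma> c p (e i) (e j)
                    + h b p $ i $ j *\<^sub>R \<xi> c p \<in> T)
         \<and> (\<forall>i. pd i (\<xi> c \<circ> cinv b) (snd b p) + christoffel_apply \<Gamma> c p (e i) (\<xi> c p) \<in> T)
         \<and> \<tau> c p powr (- (real CARD('n) + 2)) * contracted_volume c b p (\<xi> c p)
             = sqrt (det (h b p))))"

text \<open>The identification of \<open>\<E>(w)|M\<close> with \<open>\<E>[w]\<close> through \<open>\<tau>|M \<mapsto> vol\<^sub>h\<^sup>-\<^sup>1\<^sup>/\<^sup>n\<close>: the component in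
  the boundary chart \<open>b\<close> of the conformal density corresponding to \<open>F\<close>.  The value does not
  depend on the choices of the scale and of the affine chart, so \<open>SOME\<close> picks a unique
  value here.  Only the components of \<open>F\<close> in affine charts are used.\<close>

definition restrict_to_bdry ::
    "('a::topological_space, 'n::finite) proj_mfd \<Rightarrow> 'a set \<Rightarrow> real \<Rightarrow> ('a, 'n option) components
      \<Rightarrow> ('a, 'n) components" where
  "restrict_to_bdry N \<Omega> w F b p = (SOME y. \<exists>\<tau> \<Gamma> \<xi> h c.
      proj_scale N (pts N) \<tau> \<and> scale_connection N (pts N) \<tau> \<Gamma> \<and> affine_normal N \<Omega> \<tau> \<Gamma> \<xi> h
    \<and> affine_chart N c \<and> p \<in> fst c
    \<and> y = (\<tau> c p powr (- w) * F c p) * sqrt (det (h b p)) powr (- w / real CARD('n)))"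

section \<open>GJMS operators\<close>

definition smooth_extension ::
    "('a::topological_space, 'n::finite) proj_mfd \<Rightarrow> 'a set \<Rightarrow> real \<Rightarrow> ('a, 'n) components
      \<Rightarrow> ('a, 'n option) components \<Rightarrow> bool" where
  "smooth_extension N \<Omega> w f f' \<longleftrightarrow> proj_density N (pts N) w f'
     \<and> (\<forall>b\<in>bdry_atlas N \<Omega>. \<forall>p\<in>fst b. restrict_to_bdry N \<Omega> w f' b p = f b p)"

text \<open>The component of the density \<open>\<Delta>\<^sup>m f'\<close> in an affine chart is its value at \<open>t = 1\<close>.\<close>

definition ambient_laplacian_power ::
    "('a, 'n::finite option) components \<Rightarrow> nat \<Rightarrow> real \<Rightarrow> ('a, 'n option) components
      \<Rightarrow> ('a, 'n option) components" where
  "ambient_laplacian_power \<rho> m w f' c p =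
     (laplacian (ambient_metric \<rho> c) ^^ m) (ambient_fun w f' c) (ambient_point c 1 p)"

text \<open>\<open>P\<^sub>m f\<close> is computed from any smooth extension \<open>f'\<close> of \<open>f\<close>; again \<open>SOME\<close> picks a value
  which is unique.  The result is set to \<open>0\<close> outside the domain of the chart, so that equality
  of functions is equality of densities.\<close>

definition GJMS ::
    "('a::topological_space, 'n::finite) proj_mfd \<Rightarrow> 'a set \<Rightarrow> ('a, 'n option) components \<Rightarrow> nat
      \<Rightarrow> ('a, 'n) components \<Rightarrow> ('a, 'n) components" where
  "GJMS N \<Omega> \<rho> m f b p =
     (let w = real m - real CARD('n) / 2; w' = - real m - real CARD('n) / 2
      in if b \<in> bdry_atlas N \<Omega> \<and> p \<in> fst b
         then SOME y. \<exists>f'. smooth_extension N \<Omega> w f f'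
                \<and> y = restrict_to_bdry N \<Omega> w' (ambient_laplacian_power \<rho> m w f') b p
         else 0)"

end

(*
  In affine ambient coordinates a Fefferman defining density is a function R, homogeneous of degree
  2, with det(Hess R) = -1 + O(R^(n/2+1)); its ambient metric is g = Hess R, and Euler's identity
  says that the g-gradient of R is the position vector, which is tangent to {R = 0}.  Two
  consequences carry the proof.  First, if d = R' - R vanishes to order k, then modulo order k the
  determinant of Hess R' is det g times 1 + (n + 4 - 2k) Dd, where D is a normal derivative
  (this holds for k >= 2; the case k = 1 is a similar formula), so the determinant condition forces
  d to vanish to order k + 1 as long as k <= n/2 + 1.  Second, the ambient Laplacian lowers
  vanishing orders only by one, and the Laplacians of R and R' differ by an operator with values in
  order n/2.  Hence the m-th powers differ by a term of order n/2 + 1 - m >= 1, which is zero on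
  the boundary.
*)
theory Submission
  imports Defs
begin

section \<open>Smooth functions\<close>

text \<open>A perturbation d of order k puts terms of order k - 2 into the Hessian, while the
  determinant is wanted modulo order k; for small k the products of such terms cannot be discarded.
  Modulo order k, however, the terms that are not multiples of the metric form a sum of two rank-one
  matrices. They are kept exactly and absorbed into two outer factors with explicit determinants. In
  n + 4 - 2k, with k = j + 1, the summand n + 2 is the dimension, coming from the scaling of the
  metric by 1 + Dd, and -2j comes from homogeneity together with the fact that R times the normal
  derivative multiplies a leading term of order j by j. The constant first vanishes at k = n/2 + 2,
  so agreement to that order is where the argument stops. The other delicate point is that the
  Christoffel symbols contain third derivatives of d. In the Laplacian they occur contracted with
  the inverse metric, so three derivatives cost only two orders; this is the source of the order n/2
  for the difference of the Laplacians.\<close>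

lemma Ck_on_cong:
  assumes "open S" "\<And>x. x \<in> S \<Longrightarrow> f x = g x" "Ck_on k S f"
  shows "Ck_on k S g"
  using assms(2,3)
proof (induction k arbitrary: f g)
  case 0
  then show ?case by (simp cong: continuous_on_cong_simp)
next
  case (Suc k)
  have d: "g differentiable at x" if "x \<in> S" for x
    using that Suc.prems has_derivative_transform_within_open[of f _ x UNIV S g] assms(1)
    unfolding differentiable_def by (metis Ck_on.simps(2) differentiable_def)
  moreover have "frechet_derivative f (at x) = frechet_derivative g (at x)" if "x \<in> S" for x
    using that Suc.prems assms(1)
    by (auto intro: frechet_derivative_transform_within_open[of f x S g])
  moreover have "Ck_on k S (\<lambda>x. frechet_derivative g (at x) v)" for v
    by (rule Suc.IH[of "\<lambda>x. frechet_derivative f (at x) v"]) (use calculation(2) Suc.prems in auto)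
  ultimately show ?case by simp
qed

lemma Ck_on_SucD: "Ck_on (Suc k) S f \<Longrightarrow> Ck_on k S f"
proof (induction k arbitrary: f)
  case 0
  then show ?case
    by (auto intro!: continuous_at_imp_continuous_on differentiable_imp_continuous_within)
next
  case (Suc k)
  then show ?case by auto
qed

lemma Ck_on_antimono: "Ck_on k S f \<Longrightarrow> T \<subseteq> S \<Longrightarrow> Ck_on k T f"
  by (induction k arbitrary: f) (auto intro: continuous_on_subset)

lemma Ck_on_const: "Ck_on k S (\<lambda>x. c)"
  by (induction k arbitrary: c) auto

lemma Ck_on_add:
  assumes "open S" "Ck_on k S f" "Ck_on k S g"
  shows "Ck_on k S (\<lambda>x. f x + g x)"
  using assms(2,3)
proof (induction k arbitrary: f g)
  case 0
  then show ?case by (simp add: continuous_on_add)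
next
  case (Suc k)
  have "Ck_on k S (\<lambda>x. frechet_derivative (\<lambda>x. f x + g x) (at x) v)" for v
    by (rule Ck_on_cong[OF assms(1) _ Suc.IH[of "\<lambda>x. frechet_derivative f (at x) v"
              "\<lambda>x. frechet_derivative g (at x) v"]])
      (use Suc.prems in \<open>auto intro!: fun_cong[OF frechet_derivative_at] derivative_eq_intros
          simp: frechet_derivative_works[symmetric]\<close>)
  then show ?case using Suc.prems by auto
qed

lemma Ck_on_mult:
  fixes f g :: "'v::real_normed_vector \<Rightarrow> 'b::real_normed_algebra"
  assumes "open S" "Ck_on k S f" "Ck_on k S g"
  shows "Ck_on k S (\<lambda>x. f x * g x)"
  using assms(2,3)
proof (induction k arbitrary: f g)
  case 0
  then show ?case by (simp add: continuous_on_mult)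
next
  case (Suc k)
  have fg: "Ck_on k S f" "Ck_on k S g"
    "Ck_on k S (\<lambda>x. frechet_derivative f (at x) v)" "Ck_on k S (\<lambda>x. frechet_derivative g (at x) v)" for v
    using Suc.prems Ck_on_SucD by auto
  have D: "frechet_derivative (\<lambda>x. f x * g x) (at x) v
      = f x * frechet_derivative g (at x) v + frechet_derivative f (at x) v * g x" if "x \<in> S" for x v
  proof -
    have "((\<lambda>x. f x * g x) has_derivative (\<lambda>v. f x * frechet_derivative g (at x) v
        + frechet_derivative f (at x) v * g x)) (at x)"
      by (rule has_derivative_mult) (use Suc.prems that in \<open>auto simp: frechet_derivative_works[symmetric]\<close>)
    then show ?thesis by (simp add: frechet_derivative_at[symmetric])
  qed
  have "Ck_on k S (\<lambda>x. frechet_derivative (\<lambda>x. f x * g x) (at x) v)" for v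
    by (rule Ck_on_cong[OF assms(1) _ Ck_on_add[OF assms(1)
          Suc.IH[OF fg(1) fg(4)[of v]] Suc.IH[OF fg(3)[of v] fg(2)]]]) (simp add: D)
  then show ?case using Suc.prems by auto
qed

lemma Ck_on_linear:
  assumes "bounded_linear f"
  shows "Ck_on k S f"
proof (cases k)
  case 0
  then show ?thesis using assms by (simp add: linear_continuous_on)
next
  case (Suc j)
  have "frechet_derivative f (at x) = f" for x
    using assms by (metis bounded_linear_imp_has_derivative frechet_derivative_at)
  then show ?thesis
    using Suc assms by (auto simp: Ck_on_const bounded_linear_imp_differentiable)
qed

lemma frechet_derivative_inverse':
  fixes f :: "'v::real_normed_vector \<Rightarrow> real"
  assumes "f differentiable at x" "f x \<noteq> 0"
  shows "frechet_derivative (\<lambda>x. inverse (f x)) (at x) v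
    = - (frechet_derivative f (at x) v * (inverse (f x) * inverse (f x)))"
  by (rule fun_cong[OF frechet_derivative_at, symmetric])
     (use assms in \<open>auto intro!: derivative_eq_intros simp: frechet_derivative_works[symmetric]\<close>)

lemma Ck_on_inverse:
  fixes f :: "'v::real_normed_vector \<Rightarrow> real"
  assumes "open S" "Ck_on k S f" "\<And>x. x \<in> S \<Longrightarrow> f x \<noteq> 0"
  shows "Ck_on k S (\<lambda>x. inverse (f x))"
  using assms(2)
proof (induction k)
  case 0
  then show ?case using assms(3) by (auto intro: continuous_on_inverse)
next
  case (Suc k)
  have I: "Ck_on k S (\<lambda>x. inverse (f x))" using Suc Ck_on_SucD by blast
  have "Ck_on k S (\<lambda>x. frechet_derivative (\<lambda>x. inverse (f x)) (at x) v)" for v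
  proof (rule Ck_on_cong[OF assms(1) _ Ck_on_mult[OF assms(1) Ck_on_const[of k S "-1"]
        Ck_on_mult[OF assms(1) _ Ck_on_mult[OF assms(1) I I]]]])
    show "Ck_on k S (\<lambda>x. frechet_derivative f (at x) v)" using Suc.prems by simp
  qed (use Suc.prems assms(3) in \<open>auto simp: frechet_derivative_inverse'\<close>)
  moreover have "(\<lambda>x. inverse (f x)) differentiable at x" if "x \<in> S" for x
    using that Suc.prems assms(3) by (auto intro: differentiable_inverse)
  ultimately show ?case by simp
qed

text \<open>Differentiation replaces the exponent \<open>w\<close> by \<open>w - 1\<close>, so the
  induction on the order lets \<open>w\<close> vary.\<close>

lemma Ck_on_powr:
  fixes f :: "'v::real_normed_vector \<Rightarrow> real"
  assumes "open S" "Ck_on k S f" "\<And>x. x \<in> S \<Longrightarrow> f x > 0"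
  shows "Ck_on k S (\<lambda>x. f x powr w)"
  using assms(2)
proof (induction k arbitrary: w)
  case 0
  then show ?case using assms(3) by (force intro!: continuous_intros)
next
  case (Suc k)
  have D: "((\<lambda>x. f x powr w) has_derivative
      (\<lambda>v. w * (f x powr (w - 1) * frechet_derivative f (at x) v))) (at x)" if "x \<in> S" for x
  proof -
    have "(f has_derivative frechet_derivative f (at x)) (at x)"
      using that Suc.prems by (simp add: frechet_derivative_works[symmetric])
    from has_derivative_powr[OF this has_derivative_const, of w] show ?thesis
      using assms(3)[OF that] by (simp add: powr_diff algebra_simps fun_eq_iff)
  qed
  have "Ck_on k S (\<lambda>x. frechet_derivative (\<lambda>x. f x powr w) (at x) v)" for v
  proof (rule Ck_on_cong[OF assms(1) _ Ck_on_mult[OF assms(1) Ck_on_const[of k S w]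
        Ck_on_mult[OF assms(1) Suc.IH[of "w - 1"]]]])
    show "Ck_on k S f" using Suc.prems Ck_on_SucD by blast
    show "Ck_on k S (\<lambda>x. frechet_derivative f (at x) v)" using Suc.prems by simp
  qed (simp add: D[THEN frechet_derivative_at, symmetric])
  then show ?case using D by (auto intro: differentiableI)
qed

lemma smooth_on_add: "open S \<Longrightarrow> smooth_on S f \<Longrightarrow> smooth_on S g \<Longrightarrow> smooth_on S (\<lambda>x. f x + g x)"
  by (simp add: smooth_on_def Ck_on_add)

lemma smooth_on_mult:
  fixes f g :: "'v::real_normed_vector \<Rightarrow> 'b::real_normed_algebra"
  shows "open S \<Longrightarrow> smooth_on S f \<Longrightarrow> smooth_on S g \<Longrightarrow> smooth_on S (\<lambda>x. f x * g x)"
  by (simp add: smooth_on_def Ck_on_mult)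

lemma smooth_on_const: "smooth_on S (\<lambda>x. c)"
  by (simp add: smooth_on_def Ck_on_const)

lemma smooth_on_linear: "bounded_linear f \<Longrightarrow> smooth_on S f"
  by (simp add: smooth_on_def Ck_on_linear)

lemma smooth_on_component: "smooth_on S (\<lambda>x::real^'k. x $ i)"
  by (rule smooth_on_linear) (rule bounded_linear_vec_nth)

lemma smooth_on_inverse:
  fixes f :: "'v::real_normed_vector \<Rightarrow> real"
  shows "open S \<Longrightarrow> smooth_on S f \<Longrightarrow> (\<And>x. x \<in> S \<Longrightarrow> f x \<noteq> 0) \<Longrightarrow> smooth_on S (\<lambda>x. inverse (f x))"
  by (simp add: smooth_on_def Ck_on_inverse)

lemma smooth_on_divide:
  fixes f g :: "'v::real_normed_vector \<Rightarrow> real"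
  shows "open S \<Longrightarrow> smooth_on S f \<Longrightarrow> smooth_on S g \<Longrightarrow> (\<And>x. x \<in> S \<Longrightarrow> g x \<noteq> 0)
    \<Longrightarrow> smooth_on S (\<lambda>x. f x / g x)"
  unfolding divide_inverse by (intro smooth_on_mult smooth_on_inverse)

lemma smooth_on_powr:
  fixes f :: "'v::real_normed_vector \<Rightarrow> real"
  shows "open S \<Longrightarrow> smooth_on S f \<Longrightarrow> (\<And>x. x \<in> S \<Longrightarrow> f x > 0) \<Longrightarrow> smooth_on S (\<lambda>x. f x powr w)"
  by (simp add: smooth_on_def Ck_on_powr)

lemma smooth_on_cong:
  "open S \<Longrightarrow> smooth_on S f \<Longrightarrow> (\<And>x. x \<in> S \<Longrightarrow> f x = g x) \<Longrightarrow> smooth_on S g"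
  unfolding smooth_on_def using Ck_on_cong by blast

lemma smooth_on_subset: "smooth_on S f \<Longrightarrow> T \<subseteq> S \<Longrightarrow> smooth_on T f"
  unfolding smooth_on_def using Ck_on_antimono by blast

lemma smooth_on_uminus:
  fixes f :: "'v::real_normed_vector \<Rightarrow> real"
  assumes "open S" "smooth_on S f" shows "smooth_on S (\<lambda>x. - f x)"
  using smooth_on_mult[OF assms(1) smooth_on_const[of S "-1"] assms(2)] by simp

lemma smooth_on_diff:
  fixes f g :: "'v::real_normed_vector \<Rightarrow> real"
  assumes "open S" "smooth_on S f" "smooth_on S g" shows "smooth_on S (\<lambda>x. f x - g x)"
  using smooth_on_add[OF assms(1,2) smooth_on_uminus[OF assms(1,3)]] by simp

lemma smooth_on_sum:
  assumes "open S" "\<And>i. i \<in> I \<Longrightarrow> smooth_on S (f i)"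
  shows "smooth_on S (\<lambda>x. \<Sum>i\<in>I. f i x)"
  using assms(2) by (induction I rule: infinite_finite_induct)
    (auto intro!: smooth_on_add[OF assms(1)] smooth_on_const)

lemma smooth_on_prod:
  fixes f :: "'i \<Rightarrow> 'v::real_normed_vector \<Rightarrow> real"
  assumes "open S" "\<And>i. i \<in> I \<Longrightarrow> smooth_on S (f i)"
  shows "smooth_on S (\<lambda>x. \<Prod>i\<in>I. f i x)"
  using assms(2) by (induction I rule: infinite_finite_induct)
    (auto intro!: smooth_on_mult[OF assms(1)] smooth_on_const)

lemma smooth_on_power:
  fixes f :: "'v::real_normed_vector \<Rightarrow> real"
  assumes "open S" "smooth_on S f"
  shows "smooth_on S (\<lambda>x. f x ^ k)"
  by (induction k) (auto intro!: smooth_on_mult smooth_on_const assms)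

lemma smooth_on_differentiable: "smooth_on S f \<Longrightarrow> x \<in> S \<Longrightarrow> f differentiable at x"
  unfolding smooth_on_def by (metis Ck_on.simps(2))

lemma smooth_on_continuous: "smooth_on S f \<Longrightarrow> continuous_on S f"
  unfolding smooth_on_def by (metis Ck_on.simps(1))

lemma smooth_on_pd: "smooth_on S f \<Longrightarrow> smooth_on S (pd i f)"
  unfolding smooth_on_def pd_def by (metis Ck_on.simps(2))

lemma open_smooth_pos:
  assumes "open U" "smooth_on U (F :: _ \<Rightarrow> real)"
  shows "open {x \<in> U. F x > 0}"
proof -
  have "open (U \<inter> F -` {0<..})"
    by (rule continuous_open_preimage[OF smooth_on_continuous[OF assms(2)] assms(1)]) simp
  also have "U \<inter> F -` {0<..} = {x \<in> U. F x > 0}" by auto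
  finally show ?thesis .
qed

section \<open>Smoothness of determinants and of inverse matrices\<close>

lemma smooth_on_det:
  fixes A :: "'v::real_normed_vector \<Rightarrow> real^'k::finite^'k"
  assumes "open S" "\<And>i j. smooth_on S (\<lambda>x. A x $ i $ j)"
  shows "smooth_on S (\<lambda>x. det (A x))"
  unfolding det_def
  by (intro smooth_on_sum smooth_on_mult smooth_on_prod smooth_on_const assms)

lemma matrix_inv_mult:
  fixes A :: "real^'k::finite^'k"
  assumes "det A \<noteq> 0"
  shows "A ** matrix_inv A = mat 1" "matrix_inv A ** A = mat 1"
  using someI_ex[of "\<lambda>A'. A ** A' = mat 1 \<and> A' ** A = mat 1"] assms
  unfolding matrix_inv_def invertible_det_nz[symmetric] invertible_def by auto

text \<open>Cramer's rule, applied to the \<open>j\<close>-th column of the inverse. It exhibits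
  each entry as a quotient of determinants, from which smoothness is read off.\<close>

lemma matrix_inv_component:
  fixes A :: "real^'k::finite^'k"
  assumes "det A \<noteq> 0"
  shows "matrix_inv A $ i $ j = det (\<chi> k l. if l = i then axis j 1 $ k else A $ k $ l) / det A"
proof -
  have "A ** matrix_inv A = mat 1"
    using assms by (rule matrix_inv_mult)
  then have "A *v (matrix_inv A *v axis j 1) = axis j 1"
    by (simp add: matrix_vector_mul_assoc)
  then have "matrix_inv A *v axis j 1 = (\<chi> i. det (\<chi> k l. if l = i then axis j 1 $ k else A $ k $ l) / det A)"
    by (simp only: cramer[OF assms])
  moreover have "(matrix_inv A *v axis j 1) $ i = matrix_inv A $ i $ j"
    by (simp add: matrix_vector_mult_basis column_def)
  ultimately show ?thesis by simp
qed

lemma smooth_on_matrix_inv: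
  fixes A :: "'v::real_normed_vector \<Rightarrow> real^'k::finite^'k"
  assumes "open S" "\<And>i j. smooth_on S (\<lambda>x. A x $ i $ j)" "\<And>x. x \<in> S \<Longrightarrow> det (A x) \<noteq> 0"
  shows "smooth_on S (\<lambda>x. matrix_inv (A x) $ i $ j)"
proof (rule smooth_on_cong[OF assms(1)])
  show "smooth_on S (\<lambda>x. det (\<chi> k l. if l = i then axis j 1 $ k else A x $ k $ l) / det (A x))"
  proof (intro smooth_on_divide smooth_on_det assms)
    show "smooth_on S (\<lambda>x. (\<chi> k l. if l = i then axis j 1 $ k else A x $ k $ l) $ k $ l)" for k l
      by (cases "l = i") (auto intro: smooth_on_const assms(2))
  qed
qed (simp add: matrix_inv_component assms)

section \<open>Chain rule in coordinates\<close>

lemma frechet_derivative_eq_sum_pd: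
  fixes f :: "real^'k::finite \<Rightarrow> real"
  assumes "f differentiable at x"
  shows "frechet_derivative f (at x) v = (\<Sum>i\<in>UNIV. v $ i * pd i f x)"
proof -
  have lin: "linear (frechet_derivative f (at x))" by (rule linear_frechet_derivative[OF assms])
  have "frechet_derivative f (at x) v = frechet_derivative f (at x) (\<Sum>i\<in>UNIV. v $ i *\<^sub>R axis i 1)"
    by (simp add: basis_expansion scalar_mult_eq_scaleR[symmetric])
  then show ?thesis by (simp add: linear_sum[OF lin] linear_scale[OF lin] pd_def)
qed

text \<open>Differentiating the composite gives derivatives of \<phi> times \<open>pd i f\<close> at
  \<phi>. The latter are composites of the same kind, so the induction varies \<open>f\<close> and
  keeps \<phi>.\<close>

lemma Ck_on_compose:
  fixes f :: "real^'d::finite \<Rightarrow> real" and \<phi> :: "'v::real_normed_vector \<Rightarrow> real^'d"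
  assumes "open S" "open V" "\<And>x. x \<in> S \<Longrightarrow> \<phi> x \<in> V" "\<And>i. smooth_on S (\<lambda>x. \<phi> x $ i)"
  shows "smooth_on V f \<Longrightarrow> Ck_on k S (\<lambda>x. f (\<phi> x))"
proof (induction k arbitrary: f)
  case 0
  have "continuous_on S \<phi>"
    using continuous_on_vec_lambda[of S "\<lambda>i x. \<phi> x $ i"] smooth_on_continuous[OF assms(4)] by simp
  then show ?case
    using continuous_on_compose2[OF smooth_on_continuous[OF 0]] assms(3) by auto
next
  case (Suc k)
  have D: "((\<lambda>x. f (\<phi> x)) has_derivative
      (\<lambda>v. \<Sum>i\<in>UNIV. frechet_derivative (\<lambda>x. \<phi> x $ i) (at x) v * pd i f (\<phi> x))) (at x)" if x: "x \<in> S" for x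
  proof -
    have "((\<lambda>x. \<phi> x $ i) has_derivative frechet_derivative (\<lambda>x. \<phi> x $ i) (at x)) (at x)" for i
      using smooth_on_differentiable[OF assms(4) x] by (simp add: frechet_derivative_works[symmetric])
    then have "(\<phi> has_derivative (\<lambda>v. \<chi> i. frechet_derivative (\<lambda>x. \<phi> x $ i) (at x) v)) (at x)"
      by (subst has_derivative_componentwise_within)
        (auto simp: Basis_vec_def inner_axis)
    moreover have fd: "f differentiable at (\<phi> x)"
      using smooth_on_differentiable[OF Suc.prems] assms(3) x by blast
    then have "(f has_derivative frechet_derivative f (at (\<phi> x))) (at (\<phi> x))"
      by (simp add: frechet_derivative_works[symmetric])
    ultimately have "((\<lambda>x. f (\<phi> x)) has_derivative
        (\<lambda>v. frechet_derivative f (at (\<phi> x)) (\<chi> i. frechet_derivative (\<lambda>x. \<phi> x $ i) (at x) v))) (at x)"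
      using has_derivative_compose by blast
    then show ?thesis by (simp add: frechet_derivative_eq_sum_pd[OF fd])
  qed
  have "Ck_on k S (\<lambda>x. frechet_derivative (\<lambda>x. f (\<phi> x)) (at x) v)" for v
  proof (rule Ck_on_cong[OF assms(1)])
    have "Ck_on k S (\<lambda>x. frechet_derivative (\<lambda>x. \<phi> x $ i) (at x) v * pd i f (\<phi> x))" for i
    proof (rule Ck_on_mult[OF assms(1)])
      show "Ck_on k S (\<lambda>x. frechet_derivative (\<lambda>x. \<phi> x $ i) (at x) v)"
        using assms(4)[of i] unfolding smooth_on_def by (metis Ck_on.simps(2))
    qed (rule Suc.IH[OF smooth_on_pd[OF Suc.prems]])
    then have "Ck_on k S (\<lambda>x. \<Sum>i\<in>A. frechet_derivative (\<lambda>x. \<phi> x $ i) (at x) v * pd i f (\<phi> x))" for A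
      by (induction A rule: infinite_finite_induct) (auto intro: Ck_on_const Ck_on_add[OF assms(1)])
    then show "Ck_on k S (\<lambda>x. \<Sum>i\<in>UNIV. frechet_derivative (\<lambda>x. \<phi> x $ i) (at x) v * pd i f (\<phi> x))" .
  qed (simp add: frechet_derivative_at[OF D, symmetric])
  then show ?case using D by (auto intro: differentiableI)
qed

lemma smooth_on_compose:
  fixes f :: "real^'d::finite \<Rightarrow> real" and \<phi> :: "'v::real_normed_vector \<Rightarrow> real^'d"
  assumes "open S" "open V" "\<And>x. x \<in> S \<Longrightarrow> \<phi> x \<in> V" "\<And>i. smooth_on S (\<lambda>x. \<phi> x $ i)" "smooth_on V f"
  shows "smooth_on S (\<lambda>x. f (\<phi> x))"
  unfolding smooth_on_def using Ck_on_compose[OF assms] by blast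

text \<open>Serves Euler's identity, with \<open>v = x\<close>, and the comparison of signs across a
  hypersurface, with a transversal \<open>v\<close>.\<close>

lemma DERIV_along_line:
  fixes F :: "real^'k::finite \<Rightarrow> real"
  assumes "F differentiable at x"
  shows "((\<lambda>s. F (x + s *\<^sub>R v)) has_real_derivative (\<Sum>I\<in>UNIV. v $ I * pd I F x)) (at 0)"
proof -
  have F: "(F has_derivative frechet_derivative F (at x)) (at (x + 0 *\<^sub>R v))"
    using assms by (simp add: frechet_derivative_works[symmetric])
  have "((\<lambda>s. x + s *\<^sub>R v) has_derivative (\<lambda>t. t *\<^sub>R v)) (at 0)"
    by (auto intro!: derivative_eq_intros)
  from has_derivative_compose[OF this, of F] F
  have "((\<lambda>s. F (x + s *\<^sub>R v)) has_derivative (\<lambda>t. frechet_derivative F (at x) (t *\<^sub>R v))) (at 0)"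
    by blast
  then show ?thesis
    using linear_scale[OF linear_frechet_derivative[OF assms], of _ v]
    by (simp add: has_field_derivative_def frechet_derivative_eq_sum_pd[OF assms, symmetric] mult_commute_abs)
qed

section \<open>Rules for partial derivatives and symmetry of second derivatives\<close>

lemma pd_cong:
  assumes "open S" "x \<in> S" "\<And>y. y \<in> S \<Longrightarrow> f y = g y"
  shows "pd i f x = pd i g x"
proof (cases "f differentiable at x")
  case True
  then show ?thesis
    unfolding pd_def using frechet_derivative_transform_within_open[of f x S g] assms by auto
next
  case False
  then have "\<not> g differentiable at x"
    using has_derivative_transform_within_open[of g _ x UNIV S f] assms by (auto simp: differentiable_def)
  \<comment> \<open>Without a derivative, \<open>frechet_derivative\<close> is a choice from an
    everywhere false predicate, hence the same value for \<open>f\<close> and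
    \<open>g\<close>.\<close>
  with False have "(SOME f'. (f has_derivative f') (at x)) = (SOME f'. (g has_derivative f') (at x))"
    by (metis differentiableI)
  then show ?thesis unfolding pd_def frechet_derivative_def by simp
qed

lemma pd_add: "f differentiable at x \<Longrightarrow> g differentiable at x \<Longrightarrow>
   pd i (\<lambda>x. f x + g x) x = pd i f x + pd i g x"
  unfolding pd_def by (rule fun_cong[OF frechet_derivative_at, symmetric])
    (auto intro!: derivative_eq_intros simp: frechet_derivative_works[symmetric])

lemma pd_diff: "f differentiable at x \<Longrightarrow> g differentiable at x \<Longrightarrow>
   pd i (\<lambda>x. f x - g x) x = pd i f x - pd i g x"
  unfolding pd_def by (rule fun_cong[OF frechet_derivative_at, symmetric])
    (auto intro!: derivative_eq_intros simp: frechet_derivative_works[symmetric])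

lemma pd_mult:
  fixes f g :: "real^'k::finite \<Rightarrow> real"
  assumes "f differentiable at x" "g differentiable at x"
  shows "pd i (\<lambda>x. f x * g x) x = pd i f x * g x + f x * pd i g x"
proof -
  have "((\<lambda>x. f x * g x) has_derivative (\<lambda>v. f x * frechet_derivative g (at x) v
        + frechet_derivative f (at x) v * g x)) (at x)"
    by (rule has_derivative_mult) (use assms in \<open>auto simp: frechet_derivative_works[symmetric]\<close>)
  then show ?thesis by (simp add: pd_def frechet_derivative_at[symmetric])
qed

lemma pd_const: "pd i (\<lambda>x. c) x = 0"
  by (simp add: pd_def)

lemma pd_component: "pd i (\<lambda>x::real^'k::finite. x $ j) x = (if i = j then 1 else 0)"
proof -
  have "frechet_derivative (\<lambda>x::real^'k. x $ j) (at x) = (\<lambda>x. x $ j)"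
    by (rule frechet_derivative_at[symmetric]) (rule bounded_linear_imp_has_derivative[OF bounded_linear_vec_nth])
  then show ?thesis by (simp add: pd_def axis_def)
qed

lemma pd_sum:
  assumes "\<And>j. j \<in> I \<Longrightarrow> f j differentiable at x"
  shows "pd i (\<lambda>x. \<Sum>j\<in>I. f j x) x = (\<Sum>j\<in>I. pd i (f j) x)"
  unfolding pd_def
  by (rule fun_cong[OF frechet_derivative_at, symmetric])
    (use assms in \<open>auto intro!: derivative_eq_intros simp: frechet_derivative_works[symmetric]\<close>)

lemma pd_inverse:
  fixes f :: "real^'k::finite \<Rightarrow> real"
  assumes "f differentiable at x" "f x \<noteq> 0"
  shows "pd i (\<lambda>x. inverse (f x)) x = - (pd i f x * (inverse (f x) * inverse (f x)))"
  unfolding pd_def using frechet_derivative_inverse'[OF assms] by simp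

text \<open>The mean value theorem is applied twice: in direction \<open>i\<close> to the increment
  of \<open>f\<close> in direction \<open>j\<close>, then in direction \<open>j\<close> to
  \<open>pd i f\<close>. The left-hand side is symmetric in \<open>i\<close> and \<open>j\<close>,
  which is what makes second derivatives commute.\<close>

lemma second_difference_mvt:
  fixes f :: "real^'k::finite \<Rightarrow> real"
  assumes "smooth_on S f" "0 < h"
    and inS: "\<And>s t. 0 \<le> s \<Longrightarrow> s \<le> h \<Longrightarrow> 0 \<le> t \<Longrightarrow> t \<le> h \<Longrightarrow> x + s *\<^sub>R axis i 1 + t *\<^sub>R axis j 1 \<in> S"
  obtains s t where "0 < s" "s < h" "0 < t" "t < h"
    "f (x + h *\<^sub>R axis i 1 + h *\<^sub>R axis j 1) - f (x + h *\<^sub>R axis i 1) - f (x + h *\<^sub>R axis j 1) + f x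
      = h * h * pd j (pd i f) (x + s *\<^sub>R axis i 1 + t *\<^sub>R axis j 1)"
proof -
  let ?a = "axis i 1 :: real^'k" and ?b = "axis j 1 :: real^'k"
  have along: "((\<lambda>s. F (y + s *\<^sub>R v)) has_real_derivative frechet_derivative F (at (y + s *\<^sub>R v)) v) (at s)"
    if "smooth_on S F" "y + s *\<^sub>R v \<in> S" for F :: "real^'k \<Rightarrow> real" and y v s
  proof -
    have F: "(F has_derivative frechet_derivative F (at (y + s *\<^sub>R v))) (at (y + s *\<^sub>R v))"
      using smooth_on_differentiable[OF that] by (simp add: frechet_derivative_works[symmetric])
    have "((\<lambda>s. y + s *\<^sub>R v) has_derivative (\<lambda>t. t *\<^sub>R v)) (at s)"
      by (auto intro!: derivative_eq_intros)
    from has_derivative_compose[OF this, of F] F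
    have "((\<lambda>s. F (y + s *\<^sub>R v)) has_derivative (\<lambda>t. frechet_derivative F (at (y + s *\<^sub>R v)) (t *\<^sub>R v))) (at s)"
      by blast
    then show ?thesis
      using linear_scale[OF linear_frechet_derivative[OF smooth_on_differentiable[OF that]]]
      by (simp add: has_field_derivative_def mult.commute[of _ "frechet_derivative F _ _"])
  qed
  define p where "p s = f (x + h *\<^sub>R ?b + s *\<^sub>R ?a) - f (x + s *\<^sub>R ?a)" for s
  have "(p has_real_derivative (pd i f (x + h *\<^sub>R ?b + s *\<^sub>R ?a) - pd i f (x + s *\<^sub>R ?a))) (at s)"
    if "0 \<le> s" "s \<le> h" for s
    unfolding p_def pd_def
    by (intro DERIV_diff along[OF assms(1)])
      (use inS[of s h] inS[of s 0] that assms(2) in \<open>auto simp: algebra_simps\<close>)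
  from MVT2[OF assms(2) this] obtain s where s: "0 < s" "s < h"
    and ps: "p h - p 0 = h * (pd i f (x + h *\<^sub>R ?b + s *\<^sub>R ?a) - pd i f (x + s *\<^sub>R ?a))"
    by auto
  have "((\<lambda>t. pd i f (x + s *\<^sub>R ?a + t *\<^sub>R ?b)) has_real_derivative
      pd j (pd i f) (x + s *\<^sub>R ?a + t *\<^sub>R ?b)) (at t)" if "0 \<le> t" "t \<le> h" for t
    unfolding pd_def[of j]
    by (intro along smooth_on_pd assms(1)) (use inS[of s t] that s in auto)
  from MVT2[OF assms(2) this] obtain t where t: "0 < t" "t < h"
    and "pd i f (x + s *\<^sub>R ?a + h *\<^sub>R ?b) - pd i f (x + s *\<^sub>R ?a)
      = h * pd j (pd i f) (x + s *\<^sub>R ?a + t *\<^sub>R ?b)"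
    by auto
  with ps have "p h - p 0 = h * h * pd j (pd i f) (x + s *\<^sub>R ?a + t *\<^sub>R ?b)"
    by (simp add: algebra_simps)
  then show thesis
    using that[OF s t] by (simp add: p_def algebra_simps)
qed

text \<open>The same second difference equals \<open>h * h\<close> times either mixed derivative at
  some point near \<open>x\<close>, and both mixed derivatives are continuous.\<close>

lemma pd_commute:
  fixes f :: "real^'k::finite \<Rightarrow> real"
  assumes "open S" "smooth_on S f" "x \<in> S"
  shows "pd i (pd j f) x = pd j (pd i f) x"
proof -
  have le: "\<bar>pd i (pd j f) x - pd j (pd i f) x\<bar> \<le> 2 * e" if "e > 0" for e
  proof -
    have ev: "\<exists>d>0. \<forall>y. dist y x < d \<longrightarrow> y \<in> S \<and> \<bar>pd k (pd l f) y - pd k (pd l f) x\<bar> < e" for k l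
    proof -
      have "continuous (at x) (pd k (pd l f))"
        using smooth_on_continuous[OF smooth_on_pd[OF smooth_on_pd[OF assms(2)]]] assms(1,3)
        by (simp add: continuous_on_eq_continuous_at)
      then have "\<forall>\<^sub>F y in nhds x. \<bar>pd k (pd l f) y - pd k (pd l f) x\<bar> < e"
        using \<open>e > 0\<close> unfolding continuous_at
        by (auto simp: tendsto_iff dist_real_def at_within_def eventually_inf_principal
            elim!: eventually_mono)
      moreover have "\<forall>\<^sub>F y in nhds x. y \<in> S" using assms(1,3) by (rule eventually_nhds_in_open)
      ultimately have "\<forall>\<^sub>F y in nhds x. y \<in> S \<and> \<bar>pd k (pd l f) y - pd k (pd l f) x\<bar> < e"
        by (rule eventually_conj[rotated])
      then show ?thesis by (simp add: eventually_nhds_metric)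
    qed
    obtain d1 where d1: "d1 > 0" "\<And>y. dist y x < d1 \<Longrightarrow> y \<in> S \<and> \<bar>pd i (pd j f) y - pd i (pd j f) x\<bar> < e"
      using ev by blast
    obtain d2 where d2: "d2 > 0" "\<And>y. dist y x < d2 \<Longrightarrow> y \<in> S \<and> \<bar>pd j (pd i f) y - pd j (pd i f) x\<bar> < e"
      using ev by blast
    \<comment> \<open>A displacement has norm at most \<open>2 * h\<close>, so a third of the radius
      keeps it strictly inside.\<close>
    define h where "h = min d1 d2 / 3"
    have h: "h > 0" using d1 d2 by (simp add: h_def)
    have near: "dist (x + s *\<^sub>R axis k 1 + t *\<^sub>R axis l 1) x < min d1 d2"
      if "0 \<le> s" "s \<le> h" "0 \<le> t" "t \<le> h" for s t k l
    proof -
      have "norm (s *\<^sub>R axis k 1 + t *\<^sub>R axis l 1 :: real^'k) \<le> s + t"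
        using norm_triangle_ineq[of "s *\<^sub>R axis k 1" "t *\<^sub>R axis l 1 :: real^'k"] that by (simp add: norm_axis_1)
      also have "\<dots> < min d1 d2" using that d1 d2 by (simp add: h_def)
      finally show ?thesis by (simp add: dist_norm add.assoc)
    qed
    have S: "x + s *\<^sub>R axis k 1 + t *\<^sub>R axis l 1 \<in> S"
      if "0 \<le> s" "s \<le> h" "0 \<le> t" "t \<le> h" for s t k l
      using near[OF that] d1 by simp
    obtain s1 t1 where 1: "0 < s1" "s1 < h" "0 < t1" "t1 < h"
      and e1: "f (x + h *\<^sub>R axis i 1 + h *\<^sub>R axis j 1) - f (x + h *\<^sub>R axis i 1) - f (x + h *\<^sub>R axis j 1) + f x
      = h * h * pd j (pd i f) (x + s1 *\<^sub>R axis i 1 + t1 *\<^sub>R axis j 1)"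
      using second_difference_mvt[OF assms(2) h S] by blast
    obtain s2 t2 where 2: "0 < s2" "s2 < h" "0 < t2" "t2 < h"
      and e2: "f (x + h *\<^sub>R axis j 1 + h *\<^sub>R axis i 1) - f (x + h *\<^sub>R axis j 1) - f (x + h *\<^sub>R axis i 1) + f x
      = h * h * pd i (pd j f) (x + s2 *\<^sub>R axis j 1 + t2 *\<^sub>R axis i 1)"
      using second_difference_mvt[OF assms(2) h S] by blast
    have "h * h * pd j (pd i f) (x + s1 *\<^sub>R axis i 1 + t1 *\<^sub>R axis j 1)
       = h * h * pd i (pd j f) (x + s2 *\<^sub>R axis j 1 + t2 *\<^sub>R axis i 1)"
      unfolding e1[symmetric] e2[symmetric] by (simp add: algebra_simps)
    then have "pd j (pd i f) (x + s1 *\<^sub>R axis i 1 + t1 *\<^sub>R axis j 1)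
       = pd i (pd j f) (x + s2 *\<^sub>R axis j 1 + t2 *\<^sub>R axis i 1)" using h by simp
    moreover have "\<bar>pd j (pd i f) (x + s1 *\<^sub>R axis i 1 + t1 *\<^sub>R axis j 1) - pd j (pd i f) x\<bar> < e"
      using d2(2) near[of s1 t1 i j] 1 by simp
    moreover have "\<bar>pd i (pd j f) (x + s2 *\<^sub>R axis j 1 + t2 *\<^sub>R axis i 1) - pd i (pd j f) x\<bar> < e"
      using d1(2) near[of s2 t2 j i] 2 by simp
    ultimately show ?thesis by linarith
  qed
  show ?thesis
  proof (rule ccontr)
    assume "\<not> ?thesis"
    then show False using le[of "\<bar>pd i (pd j f) x - pd j (pd i f) x\<bar> / 4"] by simp
  qed
qed

section \<open>Vanishing order along a hypersurface\<close>

text \<open>Vanishing order is recorded through iterated partial derivatives rather than through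
  division by a power of the defining function: this makes Hadamard's lemma unnecessary.\<close>

primrec vanishes :: "nat \<Rightarrow> (real^'k::finite) set \<Rightarrow> (real^'k) set \<Rightarrow> (real^'k \<Rightarrow> real) \<Rightarrow> bool" where
  "vanishes 0 U Z F \<longleftrightarrow> smooth_on U F"
| "vanishes (Suc k) U Z F \<longleftrightarrow>
     smooth_on U F \<and> (\<forall>x\<in>Z. F x = 0) \<and> (\<forall>I. vanishes k U Z (pd I F))"

text \<open>The direction v is corrected to v + \<theta> e with \<theta> between -\<epsilon> and
  \<epsilon>. Over a short step R changes sign as \<theta> runs through this interval, so the
  intermediate value theorem finds a \<theta> for which the step ends on the zero set, where F
  vanishes too. Hence the derivative of F along v is bounded by a multiple of \<epsilon>. No
  parametrization of the zero set enters.\<close>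

lemma tangential_derivative_eq_0:
  fixes F R :: "real^'k::finite \<Rightarrow> real"
  assumes "open U" "x \<in> U" "continuous_on U R" "R differentiable at x" "F differentiable at x"
    and "R x = 0" and zero: "\<And>y. y \<in> U \<Longrightarrow> R y = 0 \<Longrightarrow> F y = 0"
    and e: "frechet_derivative R (at x) e > 0" and v: "frechet_derivative R (at x) v = 0"
  shows "frechet_derivative F (at x) v = 0"
proof -
  let ?DR = "frechet_derivative R (at x)" and ?DF = "frechet_derivative F (at x)"
  \<comment> \<open>Bounds the norm of v + \<theta> e when \<theta> is at most 1 in absolute value;
    the summand 1 makes it positive.\<close>
  define C where "C = norm v + norm e + 1"
  have C: "C > 0" unfolding C_def using norm_ge_zero[of v] norm_ge_zero[of e] by linarith
  have linR: "linear ?DR" and linF: "linear ?DF"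
    by (rule linear_frechet_derivative assms)+
  have approx: "\<exists>d>0. \<forall>h. norm h < d \<longrightarrow> \<bar>G (x + h) - G x - frechet_derivative G (at x) h\<bar> \<le> \<eta> * norm h"
    if G: "\<eta> > 0" "G differentiable at x" for \<eta> and G :: "real^'k \<Rightarrow> real"
  proof -
    have "(G has_derivative frechet_derivative G (at x)) (at x)"
      using G by (simp add: frechet_derivative_works[symmetric])
    then obtain d where d: "d > 0" "\<And>y. norm (y - x) < d \<Longrightarrow>
        norm (G y - G x - frechet_derivative G (at x) (y - x)) \<le> \<eta> * norm (y - x)"
      using G(1) by (metis has_derivative_at_alt)
    have "\<bar>G (x + h) - G x - frechet_derivative G (at x) h\<bar> \<le> \<eta> * norm h" if "norm h < d" for h
      using d(2)[of "x + h"] that by simp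
    with d(1) show ?thesis by blast
  qed
  have le: "\<bar>?DF v\<bar> \<le> \<epsilon> * (\<bar>?DF e\<bar> + C)" if \<epsilon>: "0 < \<epsilon>" "\<epsilon> < 1" for \<epsilon>
  proof -
    \<comment> \<open>Over a step of norm at most \<open>t * C\<close> the error in R is then half
      of \<open>t * \<epsilon> * ?DR e\<close>, the size of the linear term at the ends of the
      interval for \<theta>, so the linear term decides the sign there.\<close>
    define \<eta> where "\<eta> = \<epsilon> * ?DR e / (2 * C)"
    have \<eta>: "\<eta> > 0" using e \<epsilon> C by (simp add: \<eta>_def)
    obtain d1 where d1: "d1 > 0" "\<And>h. norm h < d1 \<Longrightarrow> \<bar>R (x + h) - R x - ?DR h\<bar> \<le> \<eta> * norm h"
      using approx[OF \<eta> assms(4)] by blast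
    obtain d2 where d2: "d2 > 0" "\<And>h. norm h < d2 \<Longrightarrow> \<bar>F (x + h) - F x - ?DF h\<bar> \<le> \<epsilon> * norm h"
      using approx[OF \<epsilon>(1) assms(5)] by blast
    obtain d3 where d3: "d3 > 0" "\<And>y. dist y x < d3 \<Longrightarrow> y \<in> U"
      using assms(1,2) unfolding open_dist by blast
    define t where "t = min d1 (min d2 d3) / (2 * C)"
    have t: "t > 0" using C d1 d2 d3 by (simp add: t_def)
    define h where "h \<theta> = t *\<^sub>R (v + \<theta> *\<^sub>R e)" for \<theta>
    have nh: "norm (h \<theta>) \<le> t * C" if "\<bar>\<theta>\<bar> \<le> \<epsilon>" for \<theta>
    proof -
      have "norm (v + \<theta> *\<^sub>R e) \<le> norm v + \<bar>\<theta>\<bar> * norm e"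
        using norm_triangle_ineq[of v "\<theta> *\<^sub>R e"] by simp
      also have "\<dots> \<le> C"
        using mult_right_mono[of "\<bar>\<theta>\<bar>" 1 "norm e"] that \<epsilon> by (simp add: C_def)
      finally show ?thesis using t by (simp add: h_def)
    qed
    have small: "norm (h \<theta>) < d1 \<and> norm (h \<theta>) < d2 \<and> norm (h \<theta>) < d3" if "\<bar>\<theta>\<bar> \<le> \<epsilon>" for \<theta>
    proof -
      have "t * C = min d1 (min d2 d3) / 2" using C by (simp add: t_def)
      then show ?thesis using nh[OF that] d1 d2 d3 by linarith
    qed
    have Rh: "\<bar>R (x + h \<theta>) - t * \<theta> * ?DR e\<bar> \<le> t * (\<epsilon> * ?DR e / 2)" if "\<bar>\<theta>\<bar> \<le> \<epsilon>" for \<theta>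
    proof -
      have "?DR (h \<theta>) = t * \<theta> * ?DR e"
        by (simp add: h_def linear_scale[OF linR] linear_add[OF linR] v)
      moreover have "\<eta> * norm (h \<theta>) \<le> \<eta> * (t * C)"
        using nh[OF that] \<eta> by (intro mult_left_mono) auto
      moreover have "\<eta> * (t * C) = t * (\<epsilon> * ?DR e / 2)" using C by (simp add: \<eta>_def)
      ultimately show ?thesis using d1(2)[of "h \<theta>"] small[OF that] assms(6) by simp
    qed
    have pos: "0 < \<epsilon> * (t * ?DR e)" using t \<epsilon> e by simp
    have "R (x + h \<epsilon>) \<ge> 0"
      using abs_le_D2[OF Rh[of \<epsilon>]] \<epsilon> pos by (simp add: mult.assoc)
    moreover have "R (x + h (-\<epsilon>)) \<le> 0"
      using abs_le_D1[OF Rh[of "-\<epsilon>"]] \<epsilon> pos by (simp add: mult.assoc)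
    moreover have "continuous_on {-\<epsilon>..\<epsilon>} (\<lambda>\<theta>. R (x + h \<theta>))"
    proof (rule continuous_on_compose2[OF assms(3)])
      show "(\<lambda>\<theta>. x + h \<theta>) ` {-\<epsilon>..\<epsilon>} \<subseteq> U"
        using small d3(2) by (auto simp: dist_norm abs_le_iff)
    qed (auto simp: h_def intro!: continuous_intros)
    ultimately obtain \<theta> where \<theta>: "-\<epsilon> \<le> \<theta>" "\<theta> \<le> \<epsilon>" "R (x + h \<theta>) = 0"
      using IVT'[of "\<lambda>\<theta>. R (x + h \<theta>)" "-\<epsilon>" 0 \<epsilon>] \<epsilon> by auto
    then have a\<theta>: "\<bar>\<theta>\<bar> \<le> \<epsilon>" by simp
    have "F (x + h \<theta>) = 0" "F x = 0"
      using zero \<theta>(3) small[OF a\<theta>] d3(2)[of "x + h \<theta>"] assms(2,6) by (auto simp: dist_norm)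
    then have "\<bar>?DF (h \<theta>)\<bar> \<le> \<epsilon> * norm (h \<theta>)"
      using d2(2)[of "h \<theta>"] small[OF a\<theta>] by simp
    also have "\<dots> \<le> \<epsilon> * (t * C)" using nh[OF a\<theta>] \<epsilon> by simp
    also have "?DF (h \<theta>) = t * (?DF v + \<theta> * ?DF e)"
      by (simp add: h_def linear_scale[OF linF] linear_add[OF linF])
    also have "\<bar>t * (?DF v + \<theta> * ?DF e)\<bar> = t * \<bar>?DF v + \<theta> * ?DF e\<bar>"
      using t by (simp add: abs_mult)
    also have "\<epsilon> * (t * C) = t * (\<epsilon> * C)" by simp
    finally have "\<bar>?DF v + \<theta> * ?DF e\<bar> \<le> \<epsilon> * C" using t by simp
    moreover have "\<bar>\<theta> * ?DF e\<bar> \<le> \<epsilon> * \<bar>?DF e\<bar>"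
      using a\<theta> by (simp add: abs_mult mult_right_mono)
    moreover have "\<epsilon> * (\<bar>?DF e\<bar> + C) = \<epsilon> * \<bar>?DF e\<bar> + \<epsilon> * C" by (simp only: distrib_left)
    ultimately show ?thesis by linarith
  qed
  show ?thesis
  proof (rule ccontr)
    assume ne: "?DF v \<noteq> 0"
    define B where "B = \<bar>?DF e\<bar> + C"
    have B: "B > 0" using C by (simp add: B_def add_nonneg_pos)
    \<comment> \<open>Makes the bound \<epsilon> B at most half of the quantity it bounds; the cap
      1/2 keeps \<epsilon> below 1.\<close>
    define \<epsilon> where "\<epsilon> = min (1/2) (\<bar>?DF v\<bar> / (2 * B))"
    have "0 < \<epsilon>" "\<epsilon> < 1" using ne B by (auto simp: \<epsilon>_def)
    then have "\<bar>?DF v\<bar> \<le> \<epsilon> * B" using le by (simp add: B_def)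
    also have "\<dots> \<le> \<bar>?DF v\<bar> / (2 * B) * B" using B by (intro mult_right_mono) (auto simp: \<epsilon>_def)
    also have "\<dots> = \<bar>?DF v\<bar> / 2" using B by simp
    finally show False using ne by simp
  qed
qed

text \<open>Transversality of the constant vector \<open>e\<close> is asked for on all of
  \<open>U\<close>, not only on the zero set: it is the denominator of the normalized normal field,
  which is thereby smooth on \<open>U\<close>.\<close>

locale hypersurface =
  fixes U :: "(real^'k::finite) set" and R :: "real^'k \<Rightarrow> real" and e :: "real^'k"
  assumes open_U: "open U" and smooth_R: "smooth_on U R"
    and transversal: "x \<in> U \<Longrightarrow> (\<Sum>I\<in>UNIV. e $ I * pd I R x) > 0"
begin

abbreviation Z :: "(real^'k) set" where "Z \<equiv> {x \<in> U. R x = 0}"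

abbreviation van :: "nat \<Rightarrow> (real^'k \<Rightarrow> real) \<Rightarrow> bool" where "van k \<equiv> vanishes k U Z"

lemmas smooth_intros = smooth_on_add[OF open_U] smooth_on_diff[OF open_U] smooth_on_mult[OF open_U]
  smooth_on_uminus[OF open_U] smooth_on_const smooth_on_component smooth_on_sum[OF open_U]
  smooth_on_divide[OF open_U] smooth_on_power[OF open_U] smooth_on_pd smooth_R

lemmas diffI = smooth_on_differentiable[where S = U]

lemma van_smooth: "van k F \<Longrightarrow> smooth_on U F"
  by (cases k) auto

lemma van_pd: "van (Suc k) F \<Longrightarrow> van k (pd I F)"
  by simp

lemma van_cong: "van k F \<Longrightarrow> (\<And>x. x \<in> U \<Longrightarrow> F x = G x) \<Longrightarrow> van k G"
proof (induction k arbitrary: F G)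
  case 0
  then show ?case using smooth_on_cong[OF open_U, of F G] by simp
next
  case (Suc k)
  have "van k (pd I G)" for I
    by (rule Suc.IH[OF van_pd[OF Suc.prems(1)] pd_cong[OF open_U _ Suc.prems(2)]])
  moreover have "smooth_on U G"
    by (rule smooth_on_cong[OF open_U _ Suc.prems(2)]) (use Suc.prems(1) in simp)
  moreover have "G x = 0" if "x \<in> Z" for x
    using Suc.prems(1) Suc.prems(2)[of x, symmetric] that by simp
  ultimately show ?case by simp
qed

lemma van_SucD: "van (Suc k) F \<Longrightarrow> van k F"
  by (induction k arbitrary: F) auto

lemma van_mono: "van k F \<Longrightarrow> j \<le> k \<Longrightarrow> van j F"
  by (induction k) (auto simp del: vanishes.simps simp: le_Suc_eq dest: van_SucD)

lemma van_zero: "van k (\<lambda>x. 0)"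
proof (induction k)
  case 0
  then show ?case by (simp add: smooth_on_const)
next
  case (Suc k)
  have "pd I (\<lambda>x. 0 :: real) = (\<lambda>x. 0)" for I :: 'k by (rule ext) (rule pd_const)
  then show ?case using Suc by (simp add: smooth_on_const)
qed

lemma van_add: "van k F \<Longrightarrow> van k G \<Longrightarrow> van k (\<lambda>x. F x + G x)"
proof (induction k arbitrary: F G)
  case 0
  then show ?case using smooth_on_add[OF open_U] by auto
next
  case (Suc k)
  have "van k (pd I (\<lambda>x. F x + G x))" for I
    by (rule van_cong[OF Suc.IH[of "pd I F" "pd I G"]])
      (use Suc.prems in \<open>auto intro!: pd_add[symmetric] diffI\<close>)
  then show ?case using Suc.prems smooth_on_add[OF open_U] by auto
qed

lemma van_sum: "(\<And>i. i \<in> A \<Longrightarrow> van k (F i)) \<Longrightarrow> van k (\<lambda>x. \<Sum>i\<in>A. F i x)"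
  by (induction A rule: infinite_finite_induct) (auto intro: van_add van_zero)

text \<open>Leibniz rule and induction on the total order \<open>j + k\<close>. The truncated
  \<open>j - 1\<close> records that a derivative of a factor of order 0 is still of order 0; the
  other factor then carries the whole order.\<close>

lemma van_mult: "van j F \<Longrightarrow> van k G \<Longrightarrow> van (j + k) (\<lambda>x. F x * G x)"
proof (induction "j + k" arbitrary: F G j k)
  case 0
  then show ?case using smooth_on_mult[OF open_U] by auto
next
  case (Suc n)
  have sm: "smooth_on U F" "smooth_on U G" using Suc.prems van_smooth by auto
  have pF: "van (j - 1) (pd I F)" for I
    using Suc.prems(1) smooth_on_pd[OF sm(1)] by (cases j) auto
  have pG: "van (k - 1) (pd I G)" for I
    using Suc.prems(2) smooth_on_pd[OF sm(2)] by (cases k) auto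
  have "van n (\<lambda>x. pd I F x * G x)" for I
  proof -
    have "van (n - (j - 1)) G" using Suc.prems(2) Suc.hyps(2) by (auto intro: van_mono)
    then show ?thesis using Suc.hyps(1)[OF _ pF, of "n - (j - 1)" G I] Suc.hyps(2) by auto
  qed
  moreover have "van n (\<lambda>x. F x * pd I G x)" for I
  proof -
    have "van (n - (k - 1)) F" using Suc.prems(1) Suc.hyps(2) by (auto intro: van_mono)
    then show ?thesis using Suc.hyps(1)[OF _ _ pG, of "n - (k - 1)" F I] Suc.hyps(2) by auto
  qed
  ultimately have "van n (pd I (\<lambda>x. F x * G x))" for I
    by (rule van_cong[OF van_add]) (use sm in \<open>auto intro!: pd_mult[symmetric] diffI\<close>)
  moreover have "F x * G x = 0" if "x \<in> Z" for x
    using Suc.prems Suc.hyps(2) that by (cases j; cases k) auto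
  moreover have "j + k = Suc n" using Suc.hyps(2) by simp
  ultimately show ?case using smooth_on_mult[OF open_U sm] by simp
qed

lemma van_mult_smooth: "smooth_on U F \<Longrightarrow> van k G \<Longrightarrow> van k (\<lambda>x. F x * G x)"
  using van_mult[of 0 F k G] by simp

lemma van_mult_smooth': "van k G \<Longrightarrow> smooth_on U F \<Longrightarrow> van k (\<lambda>x. G x * F x)"
  using van_mult[of k G 0 F] by simp

lemma van_uminus: "van k F \<Longrightarrow> van k (\<lambda>x. - F x)"
  using van_mult_smooth[OF smooth_on_const[of U "-1"]] by simp

lemma van_diff: "van k F \<Longrightarrow> van k G \<Longrightarrow> van k (\<lambda>x. F x - G x)"
  using van_add[OF _ van_uminus] by simp

lemma van_eq_0: "van (Suc k) F \<Longrightarrow> x \<in> U \<Longrightarrow> R x = 0 \<Longrightarrow> F x = 0"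
  by simp

lemma van_R: "van 1 R"
  using smooth_R by (auto intro: smooth_on_pd)

lemma van_R_mult: "van k F \<Longrightarrow> van (Suc k) (\<lambda>x. R x * F x)"
  using van_mult[OF van_R] by simp

lemma van_power: "van k F \<Longrightarrow> van (k * i) (\<lambda>x. F x ^ i)"
  by (induction i) (auto intro: van_mult smooth_on_const)

lemma transversal_frechet: "x \<in> U \<Longrightarrow> frechet_derivative R (at x) e > 0"
  using transversal frechet_derivative_eq_sum_pd[OF diffI[OF smooth_R]] by simp

text \<open>On the zero set the derivative vanishes by \<open>tangential_derivative_eq_0\<close>.
  Differentiating the sum once more gives first derivatives of \<open>F\<close>, whose order is
  already low enough to be assumed, and the same field applied to \<open>pd J F\<close>, to which
  the induction applies.\<close>

lemma van_tangential:
  assumes "\<And>I. smooth_on U (c I)" and tang: "\<And>x. x \<in> U \<Longrightarrow> R x = 0 \<Longrightarrow> (\<Sum>I\<in>UNIV. c I x * pd I R x) = 0"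
  shows "van k F \<Longrightarrow> van k (\<lambda>x. \<Sum>I\<in>UNIV. c I x * pd I F x)"
proof (induction k arbitrary: F)
  case 0
  then show ?case by (auto intro!: smooth_intros assms)
next
  case (Suc k)
  have sm: "smooth_on U F" using Suc.prems by simp
  have zero: "(\<Sum>I\<in>UNIV. c I x * pd I F x) = 0" if "x \<in> Z" for x
  proof -
    have x: "x \<in> U" "R x = 0" using that by auto
    have "frechet_derivative F (at x) (\<chi> I. c I x) = 0"
    proof (rule tangential_derivative_eq_0[OF open_U, where R = R and e = e])
      show "frechet_derivative R (at x) (\<chi> I. c I x) = 0"
        using tang[OF x] frechet_derivative_eq_sum_pd[OF diffI[OF smooth_R]] x by simp
    qed (use x Suc.prems transversal_frechet diffI sm smooth_R smooth_on_continuous in auto)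
    then show ?thesis using frechet_derivative_eq_sum_pd[OF diffI[OF sm]] x by simp
  qed
  have "van k (\<lambda>x. (\<Sum>I\<in>UNIV. pd J (c I) x * pd I F x) + (\<Sum>I\<in>UNIV. c I x * pd I (pd J F) x))" for J
    using Suc.prems by (intro van_add van_sum van_mult_smooth smooth_on_pd assms(1) Suc.IH) auto
  then have "van k (pd J (\<lambda>x. \<Sum>I\<in>UNIV. c I x * pd I F x))" for J
  proof (rule van_cong)
    fix x assume x: "x \<in> U"
    have "pd J (\<lambda>x. \<Sum>I\<in>UNIV. c I x * pd I F x) x
      = (\<Sum>I\<in>UNIV. pd J (\<lambda>x. c I x * pd I F x) x)"
      by (rule pd_sum) (auto intro!: diffI[OF _ x] smooth_intros assms sm)
    also have "\<dots> = (\<Sum>I\<in>UNIV. pd J (c I) x * pd I F x + c I x * pd J (pd I F) x)"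
      by (intro sum.cong refl pd_mult diffI[OF _ x] smooth_intros assms sm)
    also have "\<dots> = (\<Sum>I\<in>UNIV. pd J (c I) x * pd I F x) + (\<Sum>I\<in>UNIV. c I x * pd I (pd J F) x)"
      by (simp add: sum.distrib pd_commute[OF open_U sm x, of J])
    finally show "(\<Sum>I\<in>UNIV. pd J (c I) x * pd I F x) + (\<Sum>I\<in>UNIV. c I x * pd I (pd J F) x)
      = pd J (\<lambda>x. \<Sum>I\<in>UNIV. c I x * pd I F x) x" by simp
  qed
  moreover have "smooth_on U (\<lambda>x. \<Sum>I\<in>UNIV. c I x * pd I F x)"
    by (intro smooth_intros assms sm)
  ultimately show ?case using zero by auto
qed

text \<open>The field \<open>e\<close>, rescaled so that the derivative of \<open>R\<close> along it
  is 1.\<close>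

definition nu :: "'k \<Rightarrow> real^'k \<Rightarrow> real" where
  "nu I x = e $ I / (\<Sum>J\<in>UNIV. e $ J * pd J R x)"

definition normal :: "(real^'k \<Rightarrow> real) \<Rightarrow> real^'k \<Rightarrow> real" where
  "normal F x = (\<Sum>I\<in>UNIV. nu I x * pd I F x)"

lemma smooth_nu: "smooth_on U (nu I)"
proof -
  have "smooth_on U (\<lambda>x. e $ I / (\<Sum>J\<in>UNIV. e $ J * pd J R x))"
    by (intro smooth_intros) (use transversal in force)
  then show ?thesis by (simp add: nu_def[abs_def])
qed

lemma smooth_normal: "smooth_on U F \<Longrightarrow> smooth_on U (normal F)"
  unfolding normal_def[abs_def] by (intro smooth_intros smooth_nu)

lemma van_normal: "van (Suc k) F \<Longrightarrow> van k (normal F)"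
  unfolding normal_def[abs_def] by (intro van_sum van_mult_smooth smooth_nu van_pd)

lemma normal_R: "x \<in> U \<Longrightarrow> normal R x = 1"
  using transversal[of x]
  by (simp add: normal_def nu_def sum_divide_distrib[symmetric])

lemma normal_mult:
  assumes "smooth_on U F" "smooth_on U G" "x \<in> U"
  shows "normal (\<lambda>x. F x * G x) x = normal F x * G x + F x * normal G x"
  using pd_mult[OF diffI[OF assms(1,3)] diffI[OF assms(2,3)]]
  by (simp add: normal_def sum.distrib algebra_simps sum_distrib_left)

lemma normal_cong: "(\<And>x. x \<in> U \<Longrightarrow> F x = G x) \<Longrightarrow> x \<in> U \<Longrightarrow> normal F x = normal G x"
  unfolding normal_def using pd_cong[OF open_U, of x F G] by auto

text \<open>The \<open>I\<close>-th coordinate field minus \<open>pd I R\<close> times the normal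
  field annihilates \<open>R\<close>, so it is tangential and costs no order.\<close>

lemma van_pd_minus_normal:
  assumes "van k F"
  shows "van k (\<lambda>x. pd I F x - pd I R x * normal F x)"
proof -
  have "van k (\<lambda>x. \<Sum>J\<in>UNIV. ((if J = I then 1 else 0) - pd I R x * nu J x) * pd J F x)"
  proof (rule van_tangential[OF _ _ assms])
    fix x assume x: "x \<in> U" "R x = 0"
    have "(\<Sum>J\<in>UNIV. ((if J = I then 1 else 0) - pd I R x * nu J x) * pd J R x)
      = pd I R x - pd I R x * normal R x"
      by (simp add: left_diff_distrib sum_subtractf if_distrib[of "\<lambda>u. u * _"] normal_def
          sum_distrib_left mult.assoc cong: if_cong)
    then show "(\<Sum>J\<in>UNIV. ((if J = I then 1 else 0) - pd I R x * nu J x) * pd J R x) = 0"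
      using normal_R[OF x(1)] by simp
  qed (auto intro!: smooth_intros smooth_nu)
  then show ?thesis
    by (rule van_cong) (simp add: left_diff_distrib sum_subtractf if_distrib[of "\<lambda>u. u * _"] normal_def
          sum_distrib_left mult.assoc cong: if_cong)
qed

text \<open>The leading term of a function vanishing to order \<open>j\<close> is \<open>\<phi> R ^ j\<close>, on which \<open>R\<close> times the
  normal derivative acts as multiplication by \<open>j\<close>.\<close>

lemma van_R_normal: "van j F \<Longrightarrow> van (Suc j) (\<lambda>x. R x * normal F x - real j * F x)"
proof (induction j arbitrary: F)
  case 0
  then show ?case using van_R_mult[of 0 "normal F"] by (simp add: smooth_normal)
next
  case (Suc j)
  have sm: "smooth_on U F" using Suc.prems by simp
  \<comment> \<open>The derivative \<open>pd I\<close> of the claim consists of the claim for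
    \<open>pd I F\<close> at order \<open>j\<close>, the tangential remainder of \<open>F\<close>,
    and \<open>R\<close> times the commutator of \<open>pd I\<close> with the normal field. The
    tangential remainder also raises the factor from \<open>j\<close> to
    \<open>Suc j\<close>.\<close>
  have "van (Suc j) (\<lambda>x. (R x * normal (pd I F) x - real j * pd I F x)
      - (pd I F x - pd I R x * normal F x) + R x * (\<Sum>J\<in>UNIV. pd I (nu J) x * pd J F x))" for I
    by (intro van_diff van_add Suc.IH van_pd_minus_normal Suc.prems van_R_mult van_sum
        van_mult_smooth smooth_on_pd smooth_nu van_pd[OF Suc.prems])
  then have "van (Suc j) (pd I (\<lambda>x. R x * normal F x - real (Suc j) * F x))" for I
  proof (rule van_cong)
    fix x assume x: "x \<in> U"
    have "pd I (normal F) x = (\<Sum>J\<in>UNIV. pd I (\<lambda>x. nu J x * pd J F x) x)"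
      unfolding normal_def[abs_def]
      by (rule pd_sum) (auto intro!: diffI[OF _ x] smooth_intros smooth_nu sm)
    also have "\<dots> = (\<Sum>J\<in>UNIV. pd I (nu J) x * pd J F x + nu J x * pd I (pd J F) x)"
      by (intro sum.cong refl pd_mult diffI[OF _ x] smooth_intros smooth_nu sm)
    also have "\<dots> = (\<Sum>J\<in>UNIV. pd I (nu J) x * pd J F x) + normal (pd I F) x"
      by (simp add: sum.distrib normal_def pd_commute[OF open_U sm x, of I])
    finally have n: "pd I (normal F) x = (\<Sum>J\<in>UNIV. pd I (nu J) x * pd J F x) + normal (pd I F) x" .
    have "pd I (\<lambda>x. R x * normal F x - real (Suc j) * F x) x
      = pd I (\<lambda>x. R x * normal F x) x - pd I (\<lambda>x. real (Suc j) * F x) x"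
      by (intro pd_diff diffI[OF _ x] smooth_intros smooth_normal sm)
    also have "\<dots> = pd I R x * normal F x + R x * pd I (normal F) x - real (Suc j) * pd I F x"
      by (simp add: pd_mult diffI[OF _ x] smooth_intros smooth_normal sm pd_const)
    finally show "(R x * normal (pd I F) x - real j * pd I F x)
      - (pd I F x - pd I R x * normal F x) + R x * (\<Sum>J\<in>UNIV. pd I (nu J) x * pd J F x)
      = pd I (\<lambda>x. R x * normal F x - real (Suc j) * F x) x"
      by (simp add: n algebra_simps)
  qed
  moreover have "smooth_on U (\<lambda>x. R x * normal F x - real (Suc j) * F x)"
    by (intro smooth_intros smooth_normal sm)
  moreover have "R x * normal F x - real (Suc j) * F x = 0" if "x \<in> Z" for x
    using that Suc.prems by simp
  ultimately show ?case by (simp del: of_nat_Suc)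
qed

end

section \<open>Determinants\<close>

lemma det_row_vector_identity:
  fixes v :: "real^'k::finite"
  shows "det (\<chi> i. if i = a then v else c *s axis i 1 :: real^'k^'k) = c ^ (CARD('k) - 1) * v $ a"
proof -
  have "det (\<chi> i. (if i = a then 1 else c) *s (if i = a then v else axis i 1) :: real^'k^'k)
      = prod (\<lambda>i. if i = a then 1 else c) UNIV * det (\<chi> i. if i = a then v else axis i 1 :: real^'k^'k)"
    by (rule det_rows_mul)
  also have "(\<chi> i. (if i = a then 1 else c) *s (if i = a then v else axis i 1) :: real^'k^'k)
      = (\<chi> i. if i = a then v else c *s axis i 1)"
    by (simp add: vec_eq_iff)
  also have "prod (\<lambda>i. if i = a then 1 else c) (UNIV :: 'k set) = c ^ (CARD('k) - 1)"
    by (simp add: prod.If_cases Collect_neg_eq[symmetric] Compl_eq_Diff_UNIV card_Diff_subset)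
  also have "det (\<chi> i. if i = a then v else axis i 1 :: real^'k^'k) = v $ a"
  proof -
    have "det (\<chi> i. if i = a then \<Sum>j\<in>UNIV. v $ j *s row j (mat 1 :: real^'k^'k) else row i (mat 1) :: real^'k^'k)
      = v $ a * det (mat 1 :: real^'k^'k)"
      by (rule cramer_lemma_transpose)
    moreover have "row i (mat 1 :: real^'k^'k) = axis i 1" for i
      by (auto simp: row_def mat_def axis_def vec_eq_iff)
    ultimately show ?thesis by (simp add: basis_expansion cong: if_cong)
  qed
  finally show ?thesis .
qed

text \<open>The matrix determinant lemma, with the rows perturbed one at a time. By linearity in row
  \<open>a\<close>, perturbing it adds \<open>u a\<close> times a determinant having
  \<open>w\<close> in that row; there the earlier perturbations, being multiples of
  \<open>w\<close>, are removed by row operations. No division by \<open>c\<close> occurs.\<close>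

lemma det_scalar_plus_rank_one:
  fixes u v :: "'k::finite \<Rightarrow> real"
  shows "det (\<chi> i j. (if i = j then c else 0) + u i * v j :: real^'k^'k)
    = c ^ (CARD('k) - 1) * (c + (\<Sum>i\<in>UNIV. u i * v i))"
proof -
  define w :: "real^'k" where "w = (\<chi> j. v j)"
  define r where "r T i = (if i \<in> T then c *s axis i 1 + u i *s w else c *s axis i 1)" for T i
  have M: "det (\<chi> i. if i = a then w else r T i :: real^'k^'k) = c ^ (CARD('k) - 1) * v a"
    if "finite T" "a \<notin> T" for T a
    using that
  proof (induction T)
    case empty
    then show ?case using det_row_vector_identity[of a w c] by (simp add: r_def w_def cong: if_cong)
  next
    case (insert b T)
    let ?A = "\<chi> i. if i = a then w else r T i :: real^'k^'k"
    have "(\<chi> i. if i = a then w else r (insert b T) i)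
      = (\<chi> k. if k = b then row b ?A + u b *s row a ?A else row k ?A)"
      using insert by (auto simp: vec_eq_iff row_def r_def)
    moreover have "det (\<chi> k. if k = b then row b ?A + u b *s row a ?A else row k ?A) = det ?A"
      by (rule det_row_operation) (use insert in auto)
    ultimately show ?case using insert by simp
  qed
  have "det (\<chi> i. r T i :: real^'k^'k) = c ^ (CARD('k) - 1) * (c + (\<Sum>i\<in>T. u i * v i))"
    if "finite T" for T
    using that
  proof (induction T)
    case empty
    \<comment> \<open>An arbitrary row is singled out so that the determinant of the scalar matrix
      appears as \<open>c ^ (CARD('k) - 1) * c\<close>.\<close>
    fix a :: 'k
    have "(\<chi> i. r {} i :: real^'k^'k) = (\<chi> i. if i = a then c *s axis a 1 else c *s axis i 1)"
      by (auto simp: r_def vec_eq_iff)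
    then have "det (\<chi> i. r {} i :: real^'k^'k) = c ^ (CARD('k) - 1) * (c *s axis a 1 :: real^'k) $ a"
      by (simp only: det_row_vector_identity)
    then show ?case by simp
  next
    case (insert a T)
    have "(\<chi> i. r (insert a T) i) = (\<chi> i. if i = a then r T i + u i *s w else r T i)"
      using insert by (auto simp: vec_eq_iff r_def)
    then have "det (\<chi> i. r (insert a T) i :: real^'k^'k)
      = det (\<chi> i. if i = a then r T i else r T i :: real^'k^'k)
        + det (\<chi> i. if i = a then u i *s w else r T i :: real^'k^'k)"
      by (simp only: det_row_add)
    also have "det (\<chi> i. if i = a then u i *s w else r T i :: real^'k^'k)
       = u a * det (\<chi> i. if i = a then w else r T i :: real^'k^'k)"
    proof -
      have "det (\<chi> i. if i = a then u a *s w else r T i :: real^'k^'k)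
       = u a * det (\<chi> i. if i = a then w else r T i :: real^'k^'k)"
        by (rule det_row_mul)
      moreover have "(\<chi> i. if i = a then u i *s w else r T i :: real^'k^'k)
        = (\<chi> i. if i = a then u a *s w else r T i)" by (simp add: vec_eq_iff)
      ultimately show ?thesis by simp
    qed
    finally show ?case using insert M[of T a] by (simp add: algebra_simps)
  qed
  from this[of UNIV] have "det (\<chi> i. r UNIV i :: real^'k^'k) = c ^ (CARD('k) - 1) * (c + (\<Sum>i\<in>UNIV. u i * v i))"
    by simp
  moreover have "(\<chi> i. r UNIV i) = (\<chi> i j. (if i = j then c else 0) + u i * v j)"
    by (auto simp: vec_eq_iff r_def w_def axis_def)
  ultimately show ?thesis by simp
qed

section \<open>Determinants modulo functions of a given vanishing order\<close>

context hypersurface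
begin

lemma van_prod_cong:
  assumes "\<And>i. i \<in> A \<Longrightarrow> smooth_on U (F i)" "\<And>i. i \<in> A \<Longrightarrow> smooth_on U (G i)"
    "\<And>i. i \<in> A \<Longrightarrow> van k (\<lambda>x. F i x - G i x)"
  shows "van k (\<lambda>x. (\<Prod>i\<in>A. F i x) - (\<Prod>i\<in>A. G i x))"
  using assms
proof (induction A rule: infinite_finite_induct)
  case (insert a A)
  have "van k (\<lambda>x. (F a x - G a x) * (\<Prod>i\<in>A. F i x) + G a x * ((\<Prod>i\<in>A. F i x) - (\<Prod>i\<in>A. G i x)))"
    using insert by (intro van_add van_mult_smooth van_mult_smooth' smooth_on_prod[OF open_U]) auto
  then show ?case
    by (rule van_cong) (use insert in \<open>simp add: algebra_simps\<close>)
qed (auto intro: van_zero)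

lemma van_det_cong:
  fixes A B :: "real^'k \<Rightarrow> real^'j::finite^'j"
  assumes "\<And>i j. smooth_on U (\<lambda>x. A x $ i $ j)" "\<And>i j. smooth_on U (\<lambda>x. B x $ i $ j)"
    "\<And>i j. van k (\<lambda>x. A x $ i $ j - B x $ i $ j)"
  shows "van k (\<lambda>x. det (A x) - det (B x))"
proof -
  have "van k (\<lambda>x. \<Sum>p\<in>{p. p permutes UNIV}. of_int (sign p) *
      ((\<Prod>i\<in>UNIV. A x $ i $ p i) - (\<Prod>i\<in>UNIV. B x $ i $ p i)))"
    by (intro van_sum van_mult_smooth smooth_on_const van_prod_cong assms)
  then show ?thesis
    by (rule van_cong) (simp add: det_def sum_subtractf right_diff_distrib)
qed

end

section \<open>Homogeneous functions\<close>

definition euler :: "(real^'k::finite \<Rightarrow> real) \<Rightarrow> real^'k \<Rightarrow> real" where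
  "euler F x = (\<Sum>I\<in>UNIV. x $ I * pd I F x)"

lemma euler_mult:
  assumes "F differentiable at x" "G differentiable at x"
  shows "euler (\<lambda>x. F x * G x) x = euler F x * G x + F x * euler G x"
  using pd_mult[OF assms] by (simp add: euler_def sum.distrib algebra_simps sum_distrib_left)

lemma euler_sum:
  assumes "\<And>i. i \<in> A \<Longrightarrow> F i differentiable at x"
  shows "euler (\<lambda>x. \<Sum>i\<in>A. F i x) x = (\<Sum>i\<in>A. euler (F i) x)"
  unfolding euler_def by (simp add: pd_sum assms sum_distrib_left) (rule sum.swap)

lemma euler_const: "euler (\<lambda>x. c) x = 0"
  by (simp add: euler_def pd_const)

lemma euler_inverse:
  assumes "F differentiable at x" "F x \<noteq> 0"
  shows "euler (\<lambda>x. inverse (F x)) x = - (euler F x * (inverse (F x) * inverse (F x)))"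
  using pd_inverse[OF assms] by (simp add: euler_def sum_negf[symmetric] sum_distrib_right mult.assoc)

text \<open>Differentiating Euler's identity for \<open>F\<close> also differentiates the
  coordinates, which produces one extra \<open>pd I F\<close> and lowers the degree by one.\<close>

lemma euler_pd:
  assumes "open U" "smooth_on U F" and hom: "\<And>x. x \<in> U \<Longrightarrow> euler F x = w * F x" and "x \<in> U"
  shows "euler (pd I F) x = (w - 1) * pd I F x"
proof -
  note d = smooth_on_differentiable[OF _ \<open>x \<in> U\<close>]
  have F: "F differentiable at x" "\<And>J. pd J F differentiable at x"
    using assms(2) by (auto intro: d smooth_on_pd)
  have c: "(\<lambda>x::real^_. x $ J) differentiable at x" for J
    by (rule d[OF smooth_on_component])
  have "w * pd I F x = pd I (\<lambda>x. w * F x) x"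
    using pd_mult[of "\<lambda>x. w" x F] F by (simp add: pd_const)
  also have "\<dots> = pd I (euler F) x"
    by (rule pd_cong[OF assms(1,4)]) (simp add: hom)
  also have "\<dots> = (\<Sum>J\<in>UNIV. pd I (\<lambda>x. x $ J * pd J F x) x)"
    unfolding euler_def[abs_def] by (rule pd_sum) (simp add: c F)
  also have "\<dots> = (\<Sum>J\<in>UNIV. (if I = J then 1 else 0) * pd J F x + x $ J * pd I (pd J F) x)"
    by (simp only: pd_mult[OF c F(2)] pd_component)
  also have "\<dots> = pd I F x + euler (pd I F) x"
    by (simp add: sum.distrib euler_def pd_commute[OF assms(1,2,4), of I] if_distrib[of "\<lambda>u. u * _"] cong: if_cong)
  finally show ?thesis by (simp add: algebra_simps)
qed

text \<open>The derivative at \<open>s = 0\<close> along x + s x is computed by the chain rule and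
  by homogeneity; \<open>s\<close> stays below 1 in absolute value so that the factor 1 + s is
  positive.\<close>

lemma euler_homogeneous:
  fixes F :: "real^'k::finite \<Rightarrow> real"
  assumes "F differentiable at x" and hom: "\<And>t. t > 0 \<Longrightarrow> F (t *\<^sub>R x) = t powr w * F x"
  shows "euler F x = w * F x"
proof -
  have "((\<lambda>s. F (x + s *\<^sub>R x)) has_real_derivative euler F x) (at 0)"
    using DERIV_along_line[OF assms(1), of x] by (simp add: euler_def)
  moreover have "((\<lambda>s. F (x + s *\<^sub>R x)) has_real_derivative w * F x) (at 0)"
  proof (rule has_field_derivative_transform_within[where d = 1])
    show "((\<lambda>s. (1 + s) powr w * F x) has_real_derivative w * F x) (at 0)"
      by (auto intro!: derivative_eq_intros)
    fix s :: real assume "dist s 0 < 1"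
    then show "(1 + s) powr w * F x = F (x + s *\<^sub>R x)"
      using hom[of "1 + s"] by (simp add: scaleR_left_distrib dist_real_def abs_less_iff)
  qed simp_all
  ultimately show ?thesis by (rule DERIV_unique)
qed

section \<open>Uniqueness of Fefferman defining functions\<close>

locale homogeneous_hypersurface = hypersurface U R e for U :: "(real^'k::finite) set" and R e +
  assumes euler_R: "x \<in> U \<Longrightarrow> euler R x = 2 * R x"
begin

lemma hessian_sym: "x \<in> U \<Longrightarrow> hessian R x $ I $ J = hessian R x $ J $ I"
  using pd_commute[OF open_U smooth_R, of x I J] by (simp add: hessian_def)

lemma hessian_position: "x \<in> U \<Longrightarrow> (\<Sum>J\<in>UNIV. hessian R x $ I $ J * x $ J) = pd I R x"
  using euler_pd[OF open_U smooth_R euler_R, of x I] pd_commute[OF open_U smooth_R, of x I]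
  by (simp add: euler_def hessian_def mult.commute)

lemma smooth_hessian: "smooth_on U F \<Longrightarrow> smooth_on U (\<lambda>x. hessian F x $ I $ J)"
  by (simp add: hessian_def smooth_on_pd)

lemma euler_nu: "x \<in> U \<Longrightarrow> euler (nu J) x = - nu J x"
proof -
  assume x: "x \<in> U"
  let ?N = "\<lambda>x. \<Sum>J\<in>UNIV. e $ J * pd J R x"
  have sN: "smooth_on U ?N" by (intro smooth_intros)
  have N: "?N x \<noteq> 0" using transversal[OF x] by simp
  have "euler ?N x = ?N x"
    by (simp add: euler_sum euler_mult euler_const euler_pd[OF open_U smooth_R euler_R x]
        diffI[OF _ x] smooth_intros)
  then have "euler (\<lambda>x. inverse (?N x)) x = - inverse (?N x)"
    using euler_inverse[OF diffI[OF sN x] N] N by simp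
  moreover have "smooth_on U (\<lambda>x. inverse (?N x))"
    using transversal by (intro smooth_on_inverse[OF open_U] sN) force
  ultimately have "euler (\<lambda>x. e $ J * inverse (?N x)) x = - (e $ J * inverse (?N x))"
    by (subst euler_mult) (auto simp: euler_const intro!: diffI[OF _ x] smooth_on_const)
  then show ?thesis by (simp add: nu_def[abs_def] divide_inverse)
qed

text \<open>First derivatives of \<open>d\<close> have degree 1 and \<open>nu\<close> has degree -1.
  Degree 0 means that the differential of \<open>normal d\<close> annihilates the position vector,
  which removes the rank-one contribution to one of the determinants below.\<close>

lemma euler_normal:
  assumes "smooth_on U d" and hom: "\<And>x. x \<in> U \<Longrightarrow> euler d x = 2 * d x" and x: "x \<in> U"
  shows "euler (normal d) x = 0"
  unfolding normal_def[abs_def]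
  by (subst euler_sum) (auto simp: euler_mult euler_nu[OF x] euler_pd[OF open_U assms(1) hom x]
      diffI[OF _ x] smooth_intros smooth_nu assms(1))

text \<open>Splitting the gradient of \<open>d\<close> into \<open>D\<close> times the gradient of
  \<open>R\<close> and a tangential remainder \<open>t\<close> keeps \<open>t\<close> at the order
  of \<open>d\<close>. Differentiating again, the only low-order terms besides a multiple of
  \<open>hessian R\<close> are two products with the gradient of \<open>R\<close>, which is
  \<open>hessian R\<close> applied to the position vector. Of the resulting determinants, the left
  one is a pure power of \<open>c\<close> and the right one contributes the term in
  \<open>j\<close>.\<close>

lemma van_det_hessian:
  assumes d: "van (Suc j) d" and hom: "\<And>x. x \<in> U \<Longrightarrow> euler d x = 2 * d x"
    and pos: "\<And>x. x \<in> U \<Longrightarrow> 1 + normal d x > 0"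
  shows "van (Suc j) (\<lambda>x. det (hessian (\<lambda>x. R x + d x) x)
    - det (hessian R x) * ((1 + normal d x) ^ (CARD('k) - 1) * (1 + normal d x - 2 * real j * normal d x)))"
proof -
  define D where "D = normal d"
  define c where "c x = 1 + D x" for x
  define q where "q I = pd I D" for I
  define t where "t I x = pd I d x - pd I R x * D x" for I x
  define \<kappa> where "\<kappa> I = normal (t I)" for I
  define z where "z I J x = pd I (t J) x - pd I R x * \<kappa> J x" for I J x
  have sd: "smooth_on U d" by (rule van_smooth[OF d])
  have D: "van j D" unfolding D_def by (rule van_normal[OF d])
  have t: "van (Suc j) (t I)" for I
    unfolding t_def[abs_def] D_def by (rule van_pd_minus_normal[OF d])
  have \<kappa>: "van j (\<kappa> I)" for I unfolding \<kappa>_def by (rule van_normal[OF t])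
  have z: "van (Suc j) (z I J)" for I J
    unfolding z_def[abs_def] \<kappa>_def by (rule van_pd_minus_normal[OF t])
  \<comment> \<open>Truncated subtraction: for \<open>j = 0\<close> this states only
    smoothness.\<close>
  have q: "van (j - 1) (q I)" for I
    unfolding q_def using D smooth_on_pd[of U D I] by (cases j) auto
  note sm = van_smooth[OF D] van_smooth[OF t] van_smooth[OF \<kappa>] van_smooth[OF z] van_smooth[OF q] sd
  have c0: "c x \<noteq> 0" if "x \<in> U" for x using pos[OF that] by (simp add: c_def D_def)
  have sc: "smooth_on U c" unfolding c_def[abs_def] by (intro smooth_intros sm)
  have hess: "hessian (\<lambda>x. R x + d x) x $ I $ J
      = c x * hessian R x $ I $ J + q I x * pd J R x + pd I R x * \<kappa> J x + z I J x"
    if x: "x \<in> U" for x I J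
  proof -
    have "hessian (\<lambda>x. R x + d x) x $ I $ J = pd I (pd J (\<lambda>x. R x + d x)) x"
      by (simp add: hessian_def)
    also have "\<dots> = pd I (\<lambda>x. pd J R x + (pd J R x * D x + t J x)) x"
      by (rule pd_cong[OF open_U x]) (simp add: t_def pd_add diffI smooth_R sd)
    also have "\<dots> = pd I (pd J R) x + (pd I (pd J R) x * D x + pd J R x * pd I D x + pd I (t J) x)"
      by (simp add: pd_add pd_mult diffI[OF _ x] smooth_intros sm)
    finally show ?thesis by (simp add: c_def z_def q_def hessian_def algebra_simps)
  qed
  have xq: "(\<Sum>I\<in>UNIV. q I x * x $ I) = 0" if "x \<in> U" for x
    using euler_normal[OF sd hom that] by (simp add: q_def D_def euler_def mult.commute)
  \<comment> \<open>Euler's identity for \<open>d\<close> and \<open>R\<close> gives 2 d - 2 R D for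
    the contraction of \<open>t\<close> with the position vector. Taking its normal derivative also
    differentiates the position vector, but this yields the contraction of \<open>nu\<close> with
    \<open>t\<close>, which is zero because \<open>normal R\<close> is 1.\<close>
  have x\<kappa>: "(\<Sum>I\<in>UNIV. x $ I * \<kappa> I x) = - 2 * R x * normal D x" if x: "x \<in> U" for x
  proof -
    have "(\<Sum>I\<in>UNIV. y $ I * t I y) = 2 * d y + (- 2) * (R y * D y)" if y: "y \<in> U" for y
    proof -
      have "(\<Sum>I\<in>UNIV. y $ I * t I y) = euler d y - euler R y * D y"
        by (simp add: t_def euler_def right_diff_distrib sum_subtractf sum_distrib_right mult.assoc)
      then show ?thesis using hom[OF y] euler_R[OF y] by simp
    qed
    then have "normal (\<lambda>y. \<Sum>I\<in>UNIV. y $ I * t I y) x = normal (\<lambda>y. 2 * d y + (- 2) * (R y * D y)) x"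
      by (rule normal_cong[OF _ x])
    also have "\<dots> = 2 * D x - 2 * (D x + R x * normal D x)"
    proof -
      have a: "normal (\<lambda>y. F y + G y) x = normal F x + normal G x" if "smooth_on U F" "smooth_on U G" for F G
        using that by (simp add: normal_def pd_add diffI[OF _ x] distrib_left sum.distrib)
      have k: "normal (\<lambda>y. r) x = 0" for r by (simp add: normal_def pd_const)
      have "normal (\<lambda>y. 2 * d y + (- 2) * (R y * D y)) x
        = normal (\<lambda>y. 2 * d y) x + normal (\<lambda>y. (- 2) * (R y * D y)) x"
        by (intro a smooth_intros sm)
      also have "normal (\<lambda>y. 2 * d y) x = 2 * D x"
        by (subst normal_mult) (simp_all add: k x smooth_intros sm D_def)
      also have "normal (\<lambda>y. (- 2) * (R y * D y)) x = (- 2) * normal (\<lambda>y. R y * D y) x"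
        by (subst normal_mult) (simp_all add: k x smooth_intros sm)
      also have "normal (\<lambda>y. R y * D y) x = D x + R x * normal D x"
        by (subst normal_mult) (simp_all add: x smooth_intros sm normal_R)
      finally show ?thesis by simp
    qed
    also have "normal (\<lambda>y. \<Sum>I\<in>UNIV. y $ I * t I y) x = (\<Sum>I\<in>UNIV. nu I x * t I x + x $ I * \<kappa> I x)"
    proof -
      have "normal (\<lambda>y. \<Sum>I\<in>UNIV. y $ I * t I y) x = (\<Sum>J\<in>UNIV. \<Sum>I\<in>UNIV. nu J x * pd J (\<lambda>y. y $ I * t I y) x)"
        by (simp add: normal_def pd_sum diffI[OF _ x] smooth_intros sm sum_distrib_left)
      also have "\<dots> = (\<Sum>I\<in>UNIV. normal (\<lambda>y. y $ I * t I y) x)"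
        unfolding normal_def by (rule sum.swap)
      also have "\<dots> = (\<Sum>I\<in>UNIV. normal (\<lambda>y. y $ I) x * t I x + x $ I * \<kappa> I x)"
        by (simp add: normal_mult x smooth_intros sm \<kappa>_def)
      also have "\<dots> = (\<Sum>I\<in>UNIV. nu I x * t I x + x $ I * \<kappa> I x)"
        by (simp add: normal_def pd_component if_distrib[of "\<lambda>u. _ * u"] cong: if_cong)
      finally show ?thesis .
    qed
    also have "\<dots> = (\<Sum>I\<in>UNIV. nu I x * t I x) + (\<Sum>I\<in>UNIV. x $ I * \<kappa> I x)"
      by (rule sum.distrib)
    also have "(\<Sum>I\<in>UNIV. nu I x * t I x) = normal d x - normal R x * D x"
      by (simp add: t_def normal_def right_diff_distrib sum_subtractf sum_distrib_right mult.assoc)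
    finally show ?thesis using normal_R[OF x] by (simp add: D_def)
  qed
  text \<open>To the required order the Hessian of \<open>R + d\<close> factors through the Hessian of \<open>R\<close> and two
    perturbations of scalar matrices by rank-one matrices.\<close>
  define A where "A x = (\<chi> I J. (if I = J then c x else 0) + q I x * x $ J)" for x
  define B where "B x = (\<chi> I J. (if I = J then 1 else 0) + x $ I * (\<kappa> J x / c x))" for x
  define M where "M x = A x ** hessian R x ** B x" for x
  have detM: "det (M x) = det (hessian R x) * (c x ^ (CARD('k) - 1) * (c x - 2 * R x * normal D x))"
    if x: "x \<in> U" for x
  proof -
    have "det (A x) = c x ^ (CARD('k) - 1) * c x"
      unfolding A_def det_scalar_plus_rank_one by (simp add: xq[OF x])
    moreover have "c x * det (B x) = c x - 2 * R x * normal D x"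
    proof -
      have "det (B x) = 1 + (\<Sum>I\<in>UNIV. x $ I * \<kappa> I x) / c x"
        unfolding B_def det_scalar_plus_rank_one by (simp add: sum_divide_distrib)
      then show ?thesis using c0[OF x] by (simp add: x\<kappa>[OF x] right_diff_distrib)
    qed
    ultimately show ?thesis
      by (simp add: M_def det_mul mult.assoc mult.left_commute[of "c x"] mult.left_commute[of _ "det (hessian R x)"])
  qed
  have M: "M x $ I $ J = c x * hessian R x $ I $ J + q I x * pd J R x + pd I R x * \<kappa> J x
      + (2 * R x) * (q I x * (\<kappa> J x / c x))" if x: "x \<in> U" for x I J
  proof -
    have gx: "(\<Sum>K\<in>UNIV. x $ K * hessian R x $ K $ L) = pd L R x" for L
      using hessian_position[OF x, of L] hessian_sym[OF x, of L] by (simp add: mult.commute)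
    have Ag: "(A x ** hessian R x) $ I $ L = c x * hessian R x $ I $ L + q I x * pd L R x" for L
    proof -
      have "(A x ** hessian R x) $ I $ L = (\<Sum>K\<in>UNIV. (if I = K then c x else 0) * hessian R x $ K $ L)
          + (\<Sum>K\<in>UNIV. q I x * (x $ K * hessian R x $ K $ L))"
        by (simp add: matrix_matrix_mult_def A_def distrib_right sum.distrib mult.assoc)
      then show ?thesis
        by (simp add: sum_distrib_left[symmetric] gx if_distrib[of "\<lambda>u. u * _"] cong: if_cong)
    qed
    have "M x $ I $ J = (\<Sum>L\<in>UNIV. (A x ** hessian R x) $ I $ L * ((if L = J then 1 else 0) + x $ L * (\<kappa> J x / c x)))"
      unfolding M_def by (subst matrix_matrix_mult_def) (simp add: B_def)
    also have "\<dots> = (A x ** hessian R x) $ I $ J + (\<Sum>L\<in>UNIV. (A x ** hessian R x) $ I $ L * x $ L) * (\<kappa> J x / c x)"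
      by (simp add: distrib_left sum.distrib if_distrib[of "\<lambda>u. _ * u"] sum_distrib_right sum_divide_distrib
          mult.assoc cong: if_cong)
    also have "(\<Sum>L\<in>UNIV. (A x ** hessian R x) $ I $ L * x $ L) = c x * pd I R x + q I x * (2 * R x)"
    proof -
      have "(\<Sum>L\<in>UNIV. (A x ** hessian R x) $ I $ L * x $ L)
        = c x * (\<Sum>L\<in>UNIV. hessian R x $ I $ L * x $ L) + q I x * euler R x"
        by (simp add: Ag distrib_right sum.distrib sum_distrib_left mult.assoc euler_def mult.commute[of "pd _ R x"])
      then show ?thesis by (simp add: hessian_position[OF x] euler_R[OF x])
    qed
    finally show ?thesis using c0[OF x] by (simp add: Ag field_simps)
  qed
  have "van (Suc j) (\<lambda>x. det (hessian (\<lambda>x. R x + d x) x) - det (M x))"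
  proof (rule van_det_cong)
    show "smooth_on U (\<lambda>x. hessian (\<lambda>x. R x + d x) x $ I $ J)" for I J
      by (intro smooth_hessian smooth_intros sm)
    show "smooth_on U (\<lambda>x. M x $ I $ J)" for I J
      by (rule smooth_on_cong[OF open_U _ M[symmetric]])
        (intro smooth_intros smooth_hessian sm sc c0, assumption+)
    \<comment> \<open>The order is 1 + (j - 1) + j, that is 2j for positive \<open>j\<close> and 1
      for \<open>j = 0\<close>; in either case at least j + 1.\<close>
    have Rq\<kappa>: "van (Suc j) (\<lambda>x. R x * (q I x * \<kappa> J x))" for I J
      by (rule van_mono[OF van_R_mult[OF van_mult[OF q \<kappa>]]]) simp
    have zq: "van (Suc j) (\<lambda>x. z I J x - 2 / c x * (R x * (q I x * \<kappa> J x)))" for I J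
      by (intro van_diff z van_mult_smooth[OF _ Rq\<kappa>] smooth_intros sc c0)
    show "van (Suc j) (\<lambda>x. hessian (\<lambda>x. R x + d x) x $ I $ J - M x $ I $ J)" for I J
      by (rule van_cong[OF zq[of I J]]) (simp add: hess M mult.assoc)
  qed
  \<comment> \<open>\<open>van_R_normal\<close> exchanges \<open>R x * normal D x\<close> in the
    exact determinant for \<open>real j * D x\<close> in the claim.\<close>
  moreover have "van (Suc j) (\<lambda>x. (det (hessian R x) * c x ^ (CARD('k) - 1) * (- 2)) * (R x * normal D x - real j * D x))"
    by (intro van_mult_smooth van_R_normal D smooth_intros smooth_on_det smooth_hessian open_U sc)
  ultimately show ?thesis
    by (rule van_cong[OF van_add])
      (simp add: detM, simp add: c_def D_def[symmetric] algebra_simps)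
qed

lemma van_power_linear:
  assumes "van j D"
  shows "van (2 * j) (\<lambda>x. (1 + D x) ^ m - 1 - real m * D x)"
proof (induction m)
  case 0
  then show ?case by (simp add: van_zero)
next
  case (Suc m)
  have "van (2 * j) (\<lambda>x. (1 + D x) * ((1 + D x) ^ m - 1 - real m * D x) + real m * (D x * D x))"
    by (intro van_add van_mult_smooth[OF _ Suc] smooth_intros van_smooth[OF assms]
        van_mult_smooth[OF smooth_on_const] van_mult[OF assms assms, folded mult_2])
  then show ?case by (rule van_cong) (simp add: algebra_simps)
qed

text \<open>Dividing by the determinant of \<open>hessian R\<close> leaves the equation (1 + D)^(n +
  1) (1 + D - 2jD) = 1 modulo order j + 1. For positive \<open>j\<close> terms quadratic in
  \<open>D\<close> have order 2j, at least j + 1, so the equation is linear; for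
  \<open>j = 0\<close> it is solved pointwise on the zero set.\<close>

lemma van_defining_step:
  assumes N: "CARD('k) = n + 2" and j: "2 * j \<le> n"
    and nondeg: "\<And>x. x \<in> U \<Longrightarrow> det (hessian R x) \<noteq> 0"
    and d: "van (Suc j) d" and hom: "\<And>x. x \<in> U \<Longrightarrow> euler d x = 2 * d x"
    and pos: "\<And>x. x \<in> U \<Longrightarrow> 1 + normal d x > 0"
    and det: "van (Suc j) (\<lambda>x. det (hessian (\<lambda>x. R x + d x) x) - det (hessian R x))"
  shows "van (Suc (Suc j)) d"
proof -
  define D where "D = normal d"
  have D: "van j D" unfolding D_def by (rule van_normal[OF d])
  note sD = van_smooth[OF D]
  let ?p = "\<lambda>x. (1 + D x) ^ (CARD('k) - 1) * (1 + D x - 2 * real j * D x)"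
  have "van (Suc j) (\<lambda>x. 1 / det (hessian R x) *
     ((det (hessian (\<lambda>x. R x + d x) x) - det (hessian R x))
      - (det (hessian (\<lambda>x. R x + d x) x) - det (hessian R x) * ?p x)))"
    by (intro van_mult_smooth van_diff det van_det_hessian[OF d hom pos, folded D_def]
        smooth_intros smooth_on_det smooth_hessian open_U nondeg)
  then have p: "van (Suc j) (\<lambda>x. ?p x - 1)"
    by (rule van_cong) (use nondeg in \<open>simp add: field_simps\<close>)
  have "van (Suc j) D"
  proof (cases j)
    case 0
    have "D x = 0" if "x \<in> Z" for x
    proof -
      have x: "x \<in> U" "R x = 0" using that by auto
      have "(1 + D x) ^ (CARD('k) - 1) * (1 + D x) = 1" using van_eq_0[OF p x] 0 by simp
      then have "(1 + D x) ^ (n + 2) = 1" using N by (simp add: mult_ac)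
      moreover have "1 + D x > 0" using pos[OF x(1)] by (simp add: D_def)
      \<comment> \<open>Positivity excludes the root -1 of the power equation, which exists for even
        \<open>n\<close>.\<close>
      ultimately have "1 + D x = 1" using power_eq_iff_eq_base[of "n + 2" "1 + D x" 1] by simp
      then show ?thesis by simp
    qed
    then show ?thesis using 0 sD by (auto intro: smooth_on_pd)
  next
    case (Suc i)
    let ?m = "CARD('k) - 1"
    have "van (2 * j) (\<lambda>x. ((1 + D x) ^ ?m - 1 - real ?m * D x) * (1 + D x - 2 * real j * D x)
        + real ?m * (1 - 2 * real j) * (D x * D x))"
      by (intro van_add van_mult_smooth' van_power_linear D smooth_intros sD
          van_mult_smooth[OF smooth_on_const] van_mult[OF D D, folded mult_2])
    then have "van (Suc j) (\<lambda>x. ((1 + D x) ^ ?m - 1 - real ?m * D x) * (1 + D x - 2 * real j * D x)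
        + real ?m * (1 - 2 * real j) * (D x * D x))"
      by (rule van_mono) (use Suc in simp)
    from van_mult_smooth[OF smooth_on_const van_diff[OF p this], of "1 / (real n + 2 - 2 * real j)"]
    have "van (Suc j) (\<lambda>x. (1 / (real n + 2 - 2 * real j)) * ((?p x - 1) -
       (((1 + D x) ^ ?m - 1 - real ?m * D x) * (1 + D x - 2 * real j * D x)
        + real ?m * (1 - 2 * real j) * (D x * D x))))" .
    then show ?thesis
    proof (rule van_cong)
      fix x
      have m: "real ?m = real n + 1" using N by simp
      \<comment> \<open>The linear coefficient: n + 1 from the power and 1 - 2j from the last
        factor. It is at least 2 since \<open>2 * j \<le> n\<close>.\<close>
      have "real n + 2 - 2 * real j \<noteq> 0" using j by linarith
      moreover have "(?p x - 1) - (((1 + D x) ^ ?m - 1 - real ?m * D x) * (1 + D x - 2 * real j * D x)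
        + real ?m * (1 - 2 * real j) * (D x * D x)) = (real n + 2 - 2 * real j) * D x"
        unfolding m by (simp add: algebra_simps)
      ultimately show "(1 / (real n + 2 - 2 * real j)) * ((?p x - 1) -
       (((1 + D x) ^ ?m - 1 - real ?m * D x) * (1 + D x - 2 * real j * D x)
        + real ?m * (1 - 2 * real j) * (D x * D x))) = D x"
        by simp
    qed
  qed
  \<comment> \<open>The gain in order passes from the normal derivative back to \<open>d\<close>:
    modulo order j + 2, (j + 1) d equals R D, which has that order itself.\<close>
  then have "van (Suc (Suc j)) (\<lambda>x. (1 / real (Suc j)) * (R x * D x - (R x * D x - real (Suc j) * d x)))"
    by (intro van_mult_smooth[OF smooth_on_const] van_diff van_R_normal[OF d, folded D_def] van_R_mult)
  then show ?thesis by (rule van_cong) (simp del: of_nat_Suc)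
qed

end

section \<open>The ambient Laplacian\<close>

text \<open>The second-order part of the Laplacian of \<open>hessian R\<close>, up to sign. Applied
  to \<open>pd L R\<close> it also yields the contracted Christoffel symbols, so estimates for this
  one operator control the whole Laplacian.\<close>

definition contracted_hessian :: "(real^'k::finite \<Rightarrow> real) \<Rightarrow> (real^'k \<Rightarrow> real) \<Rightarrow> real^'k \<Rightarrow> real" where
  "contracted_hessian R F x = (\<Sum>I\<in>UNIV. \<Sum>J\<in>UNIV. matrix_inv (hessian R x) $ I $ J * pd I (pd J F) x)"

text \<open>Third derivatives of \<open>R\<close> are totally symmetric, so two of the three terms
  of each Christoffel symbol cancel and half of one third derivative remains. The rest is reordering
  of sums.\<close>

lemma laplacian_hessian:
  assumes "open U" "smooth_on U R" "x \<in> U"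
  shows "laplacian (hessian R) F x = (\<Sum>K\<in>UNIV. \<Sum>L\<in>UNIV.
     matrix_inv (hessian R x) $ K $ L * contracted_hessian R (pd L R) x * pd K F x) / 2 - contracted_hessian R F x"
proof -
  let ?h = "\<lambda>I J. matrix_inv (hessian R x) $ I $ J"
  have c: "pd J (pd I (pd L R)) x = pd I (pd J (pd L R)) x"
    and c': "pd L (pd I (pd J R)) x = pd I (pd J (pd L R)) x" for I J L
  proof -
    show "pd J (pd I (pd L R)) x = pd I (pd J (pd L R)) x" for I J L
      by (rule pd_commute[OF assms(1) smooth_on_pd[OF assms(2)] assms(3)])
    have "pd L (pd I (pd J R)) x = pd I (pd L (pd J R)) x"
      by (rule pd_commute[OF assms(1) smooth_on_pd[OF assms(2)] assms(3)])
    also have "\<dots> = pd I (pd J (pd L R)) x"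
      by (rule pd_cong[OF assms(1,3)]) (rule pd_commute[OF assms(1,2)])
    finally show "pd L (pd I (pd J R)) x = pd I (pd J (pd L R)) x" .
  qed
  have "levi_civita (hessian R) x K I J = (\<Sum>L\<in>UNIV. ?h K L * pd I (pd J (pd L R)) x) / 2" for K I J
    by (simp add: levi_civita_def hessian_def c[of J I] c'[of _ I J])
  then have "(\<Sum>I\<in>UNIV. \<Sum>J\<in>UNIV. ?h I J * (\<Sum>K\<in>UNIV. levi_civita (hessian R) x K I J * pd K F x))
     = (\<Sum>I\<in>UNIV. \<Sum>J\<in>UNIV. \<Sum>K\<in>UNIV. \<Sum>L\<in>UNIV. ?h K L * (?h I J * pd I (pd J (pd L R)) x) * pd K F x / 2)"
    by (simp add: sum_distrib_left sum_distrib_right sum_divide_distrib mult_ac)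
  also have "\<dots> = (\<Sum>K\<in>UNIV. \<Sum>L\<in>UNIV. \<Sum>I\<in>UNIV. \<Sum>J\<in>UNIV. ?h K L * (?h I J * pd I (pd J (pd L R)) x) * pd K F x / 2)"
    (is "(\<Sum>I\<in>UNIV. \<Sum>J\<in>UNIV. \<Sum>K\<in>UNIV. \<Sum>L\<in>UNIV. ?f I J K L) = _")
  proof -
    have swap: "(\<Sum>I\<in>UNIV. \<Sum>J\<in>UNIV. \<Sum>K\<in>UNIV. f I J K) = (\<Sum>K\<in>UNIV. \<Sum>I\<in>UNIV. \<Sum>J\<in>UNIV. f I J K)"
      for f :: "'a \<Rightarrow> 'a \<Rightarrow> 'a \<Rightarrow> real"
    proof -
      have "(\<Sum>I\<in>UNIV. \<Sum>J\<in>UNIV. \<Sum>K\<in>UNIV. f I J K) = (\<Sum>I\<in>UNIV. \<Sum>K\<in>UNIV. \<Sum>J\<in>UNIV. f I J K)"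
        by (rule sum.cong[OF refl], rule sum.swap)
      also have "\<dots> = (\<Sum>K\<in>UNIV. \<Sum>I\<in>UNIV. \<Sum>J\<in>UNIV. f I J K)"
        by (rule sum.swap)
      finally show ?thesis .
    qed
    show ?thesis
      by (rule trans[OF swap], rule sum.cong[OF refl], rule swap)
  qed
  also have "\<dots> = (\<Sum>K\<in>UNIV. \<Sum>L\<in>UNIV. ?h K L * contracted_hessian R (pd L R) x * pd K F x) / 2"
    by (simp add: contracted_hessian_def sum_distrib_left sum_distrib_right sum_divide_distrib)
  finally show ?thesis
    by (simp add: laplacian_def contracted_hessian_def right_diff_distrib sum_subtractf)
qed

locale nondegenerate_hypersurface = homogeneous_hypersurface U R e
  for U :: "(real^'k::finite) set" and R e +
  assumes nondeg: "x \<in> U \<Longrightarrow> det (hessian R x) \<noteq> 0"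
begin

lemma smooth_inv: "smooth_on U (\<lambda>x. matrix_inv (hessian R x) $ I $ J)"
  by (intro smooth_on_matrix_inv open_U smooth_hessian smooth_R nondeg)

lemma inv_gradient:
  assumes x: "x \<in> U"
  shows "(\<Sum>I\<in>UNIV. matrix_inv (hessian R x) $ J $ I * pd I R x) = x $ J"
    and "(\<Sum>I\<in>UNIV. matrix_inv (hessian R x) $ I $ J * pd I R x) = x $ J"
proof -
  have g: "hessian R x *v x = (\<chi> I. pd I R x)"
    by (simp add: vec_eq_iff matrix_vector_mult_def hessian_position[OF x])
  have g': "x v* hessian R x = (\<chi> I. pd I R x)"
    using hessian_position[OF x]
    by (simp add: vec_eq_iff vector_matrix_mult_def hessian_sym[OF x, of _ "_ :: 'k"] mult.commute)
  have "matrix_inv (hessian R x) *v (\<chi> I. pd I R x) = x"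
    unfolding g[symmetric] by (simp add: matrix_vector_mul_assoc matrix_inv_mult nondeg[OF x])
  then have "(matrix_inv (hessian R x) *v (\<chi> I. pd I R x)) $ J = x $ J" by simp
  then show "(\<Sum>I\<in>UNIV. matrix_inv (hessian R x) $ J $ I * pd I R x) = x $ J"
    by (simp add: matrix_vector_mult_def)
  have "(\<chi> I. pd I R x) v* matrix_inv (hessian R x) = x"
    unfolding g'[symmetric] by (simp add: vector_matrix_mul_assoc matrix_inv_mult nondeg[OF x])
  then have "((\<chi> I. pd I R x) v* matrix_inv (hessian R x)) $ J = x $ J" by simp
  then show "(\<Sum>I\<in>UNIV. matrix_inv (hessian R x) $ I $ J * pd I R x) = x $ J"
    by (simp add: vector_matrix_mult_def mult.commute)
qed

lemma smooth_contracted_hessian: "smooth_on U F \<Longrightarrow> smooth_on U (contracted_hessian R F)"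
  unfolding contracted_hessian_def[abs_def] by (intro smooth_intros smooth_inv)

lemma smooth_laplacian:
  assumes "smooth_on U F" shows "smooth_on U (laplacian (hessian R) F)"
proof (rule smooth_on_cong[OF open_U])
  show "smooth_on U (\<lambda>x. (\<Sum>K\<in>UNIV. \<Sum>L\<in>UNIV.
     matrix_inv (hessian R x) $ K $ L * contracted_hessian R (pd L R) x * pd K F x) / 2 - contracted_hessian R F x)"
    by (intro smooth_intros smooth_inv smooth_contracted_hessian assms) simp
qed (simp add: laplacian_hessian[OF open_U smooth_R])

text \<open>The gradient of \<open>R\<close> is the position vector, which is tangent to the hypersurface, so a
  contracted second derivative lowers the vanishing order only by one.\<close>

lemma van_contracted_hessian:
  assumes "van (Suc k) F"
  shows "van k (contracted_hessian R F)"
proof -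
  \<comment> \<open>For fixed \<open>J\<close>, column \<open>J\<close> of the inverse metric and
    \<open>x $ J\<close> times the normal field have the same effect on \<open>R\<close>, so their
    difference is tangential.\<close>
  have tang: "van k (\<lambda>x. \<Sum>I\<in>UNIV. (matrix_inv (hessian R x) $ I $ J - x $ J * nu I x) * pd I (pd J F) x)" for J
  proof (rule van_tangential)
    fix x assume x: "x \<in> U" "R x = 0"
    have "(\<Sum>I\<in>UNIV. (matrix_inv (hessian R x) $ I $ J - x $ J * nu I x) * pd I R x)
      = (\<Sum>I\<in>UNIV. matrix_inv (hessian R x) $ I $ J * pd I R x) - x $ J * normal R x"
      by (simp add: left_diff_distrib sum_subtractf normal_def sum_distrib_left mult.assoc)
    then show "(\<Sum>I\<in>UNIV. (matrix_inv (hessian R x) $ I $ J - x $ J * nu I x) * pd I R x) = 0"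
      using inv_gradient(2)[OF x(1)] normal_R[OF x(1)] by simp
  qed (intro smooth_intros smooth_inv smooth_nu van_pd[OF assms])+
  \<comment> \<open>In the part left over, the position vector differentiates \<open>pd I F\<close>;
    it is tangential because \<open>euler R\<close> is 2 R.\<close>
  have pos: "van k (\<lambda>x. \<Sum>J\<in>UNIV. x $ J * pd J (pd I F) x)" for I
    by (rule van_tangential) (use assms euler_R in \<open>auto simp: euler_def intro!: smooth_intros\<close>)
  have "van k (\<lambda>x. (\<Sum>J\<in>UNIV. \<Sum>I\<in>UNIV. (matrix_inv (hessian R x) $ I $ J - x $ J * nu I x) * pd I (pd J F) x)
     + (\<Sum>I\<in>UNIV. nu I x * (\<Sum>J\<in>UNIV. x $ J * pd J (pd I F) x)))"
    by (intro van_add van_sum van_mult_smooth smooth_nu tang pos)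
  then show ?thesis
  proof (rule van_cong)
    fix x assume x: "x \<in> U"
    have "(\<Sum>I\<in>UNIV. nu I x * (\<Sum>J\<in>UNIV. x $ J * pd J (pd I F) x))
       = (\<Sum>I\<in>UNIV. \<Sum>J\<in>UNIV. x $ J * nu I x * pd I (pd J F) x)"
      by (simp add: sum_distrib_left pd_commute[OF open_U van_smooth[OF assms] x, of _ "_ :: 'k"] mult_ac)
    also have "\<dots> = (\<Sum>J\<in>UNIV. \<Sum>I\<in>UNIV. x $ J * nu I x * pd I (pd J F) x)"
      by (rule sum.swap)
    moreover have "contracted_hessian R F x = (\<Sum>J\<in>UNIV. \<Sum>I\<in>UNIV. matrix_inv (hessian R x) $ I $ J * pd I (pd J F) x)"
      unfolding contracted_hessian_def by (rule sum.swap)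
    ultimately show "(\<Sum>J\<in>UNIV. \<Sum>I\<in>UNIV. (matrix_inv (hessian R x) $ I $ J - x $ J * nu I x) * pd I (pd J F) x)
     + (\<Sum>I\<in>UNIV. nu I x * (\<Sum>J\<in>UNIV. x $ J * pd J (pd I F) x)) = contracted_hessian R F x"
      by (simp add: left_diff_distrib sum_subtractf)
  qed
qed

lemma van_laplacian:
  assumes "van (Suc k) F"
  shows "van k (laplacian (hessian R) F)"
proof (rule van_cong)
  show "van k (\<lambda>x. 1 / 2 * (\<Sum>K\<in>UNIV. \<Sum>L\<in>UNIV.
     matrix_inv (hessian R x) $ K $ L * contracted_hessian R (pd L R) x * pd K F x) - contracted_hessian R F x)"
    by (intro van_diff van_contracted_hessian assms van_mult_smooth[OF smooth_on_const] van_sum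
        van_mult_smooth[OF _ van_pd[OF assms]] smooth_intros smooth_inv smooth_contracted_hessian)
qed (simp add: laplacian_hessian[OF open_U smooth_R])

lemma contracted_hessian_diff:
  assumes "smooth_on U F" "smooth_on U G" "x \<in> U"
  shows "contracted_hessian R (\<lambda>x. F x - G x) x = contracted_hessian R F x - contracted_hessian R G x"
proof -
  have "pd I (pd J (\<lambda>x. F x - G x)) x = pd I (\<lambda>x. pd J F x - pd J G x) x" for I J
    by (rule pd_cong[OF open_U assms(3)]) (simp add: pd_diff diffI assms)
  then show ?thesis
    by (simp add: contracted_hessian_def pd_diff diffI[OF _ assms(3)] smooth_intros assms right_diff_distrib sum_subtractf)
qed

lemma laplacian_diff:
  assumes "smooth_on U F" "smooth_on U G" "x \<in> U"
  shows "laplacian (hessian R) (\<lambda>x. F x - G x) x = laplacian (hessian R) F x - laplacian (hessian R) G x"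
  using assms by (simp add: laplacian_hessian[OF open_U smooth_R] contracted_hessian_diff pd_diff diffI
      right_diff_distrib sum_subtractf diff_divide_distrib)

end

text \<open>Vanishing orders and \<open>normal\<close> always refer to \<open>R\<close>;
  \<open>R'\<close> is measured against it.\<close>

locale two_defining_functions = nondegenerate_hypersurface U R e
  for U :: "(real^'k::finite) set" and R e +
  fixes R' :: "real^'k \<Rightarrow> real"
  assumes smooth_R': "smooth_on U R'" and nondeg': "x \<in> U \<Longrightarrow> det (hessian R' x) \<noteq> 0"
    and euler_R': "x \<in> U \<Longrightarrow> euler R' x = 2 * R' x"
begin

lemma smooth_inv': "smooth_on U (\<lambda>x. matrix_inv (hessian R' x) $ I $ J)"
  by (intro smooth_on_matrix_inv open_U smooth_hessian smooth_R' nondeg')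

lemma smooth_contracted_hessian': "smooth_on U F \<Longrightarrow> smooth_on U (contracted_hessian R' F)"
  unfolding contracted_hessian_def[abs_def] by (intro smooth_intros smooth_inv')

lemma smooth_laplacian':
  assumes "smooth_on U F" shows "smooth_on U (laplacian (hessian R') F)"
proof (rule smooth_on_cong[OF open_U])
  show "smooth_on U (\<lambda>x. (\<Sum>K\<in>UNIV. \<Sum>L\<in>UNIV.
     matrix_inv (hessian R' x) $ K $ L * contracted_hessian R' (pd L R') x * pd K F x) / 2 - contracted_hessian R' F x)"
    by (intro smooth_intros smooth_R' smooth_inv' smooth_contracted_hessian' assms) simp
qed (simp add: laplacian_hessian[OF open_U smooth_R'])

text \<open>For invertible A and B, B^-1 - A^-1 = - B^-1 (B - A) A^-1, and the difference of the
  Hessians loses two orders.\<close>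

lemma van_inv_diff:
  assumes "van (Suc (Suc k)) (\<lambda>x. R' x - R x)"
  shows "van k (\<lambda>x. matrix_inv (hessian R' x) $ I $ J - matrix_inv (hessian R x) $ I $ J)"
proof -
  have H: "van k (\<lambda>x. hessian R' x $ K $ L - hessian R x $ K $ L)" for K L
  proof (rule van_cong[OF van_pd[OF van_pd[OF assms]]])
    fix x assume x: "x \<in> U"
    have "pd K (pd L (\<lambda>x. R' x - R x)) x = pd K (\<lambda>x. pd L R' x - pd L R x) x"
      by (rule pd_cong[OF open_U x]) (simp add: pd_diff diffI smooth_R smooth_R')
    then show "pd K (pd L (\<lambda>x. R' x - R x)) x = hessian R' x $ K $ L - hessian R x $ K $ L"
      by (simp add: hessian_def pd_diff diffI[OF _ x] smooth_intros smooth_R')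
  qed
  have "van k (\<lambda>x. - (\<Sum>L\<in>UNIV. (\<Sum>K\<in>UNIV. matrix_inv (hessian R' x) $ I $ K *
      (hessian R' x $ K $ L - hessian R x $ K $ L)) * matrix_inv (hessian R x) $ L $ J))"
    by (intro van_uminus van_sum van_mult_smooth' van_mult_smooth[OF _ H] smooth_inv smooth_inv')
  then show ?thesis
  proof (rule van_cong)
    fix x assume x: "x \<in> U"
    let ?A = "hessian R x" and ?B = "hessian R' x"
    have sub: "matrix_inv ?B ** (?B - ?A) = matrix_inv ?B ** ?B - matrix_inv ?B ** ?A"
      by (simp add: vec_eq_iff matrix_matrix_mult_def right_diff_distrib sum_subtractf)
    have sub': "(mat 1 - matrix_inv ?B ** ?A) ** matrix_inv ?A
        = matrix_inv ?A - matrix_inv ?B ** (?A ** matrix_inv ?A)"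
    proof -
      have "(mat 1 - X) ** Y = mat 1 ** Y - X ** Y" for X Y :: "real^'k^'k"
        by (simp add: vec_eq_iff matrix_matrix_mult_def left_diff_distrib sum_subtractf)
      then show ?thesis by (simp add: matrix_mul_assoc)
    qed
    have "(matrix_inv ?B ** (?B - ?A)) ** matrix_inv ?A = matrix_inv ?A - matrix_inv ?B"
      unfolding sub by (simp add: matrix_inv_mult nondeg[OF x] nondeg'[OF x] sub')
    then have "((matrix_inv ?B ** (?B - ?A)) ** matrix_inv ?A) $ I $ J = matrix_inv ?A $ I $ J - matrix_inv ?B $ I $ J"
      by simp
    then show "- (\<Sum>L\<in>UNIV. (\<Sum>K\<in>UNIV. matrix_inv ?B $ I $ K * (?B $ K $ L - ?A $ K $ L)) * matrix_inv ?A $ L $ J)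
       = matrix_inv ?B $ I $ J - matrix_inv ?A $ I $ J"
      by (simp add: matrix_matrix_mult_def)
  qed
qed

lemma van_contracted_hessian_diff:
  assumes "van (Suc (Suc k)) (\<lambda>x. R' x - R x)" "smooth_on U F"
  shows "van k (\<lambda>x. contracted_hessian R' F x - contracted_hessian R F x)"
proof (rule van_cong)
  show "van k (\<lambda>x. \<Sum>I\<in>UNIV. \<Sum>J\<in>UNIV. (matrix_inv (hessian R' x) $ I $ J - matrix_inv (hessian R x) $ I $ J)
      * pd I (pd J F) x)"
    by (intro van_sum van_mult_smooth' van_inv_diff assms smooth_on_pd)
qed (simp add: contracted_hessian_def left_diff_distrib sum_subtractf)

text \<open>The critical term is \<open>contracted_hessian R\<close> applied to the
  \<open>L\<close>-th derivative of the difference: that derivative has order k + 1, and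
  \<open>van_contracted_hessian\<close> takes away only one more. Everything else involves second
  derivatives of the difference, through the inverse metrics.\<close>

lemma van_laplacian_diff:
  assumes d: "van (Suc (Suc k)) (\<lambda>x. R' x - R x)" and F: "smooth_on U F"
  shows "van k (\<lambda>x. laplacian (hessian R') F x - laplacian (hessian R) F x)"
proof -
  let ?h = "\<lambda>K L x. matrix_inv (hessian R x) $ K $ L" and ?h' = "\<lambda>K L x. matrix_inv (hessian R' x) $ K $ L"
  have dL: "van k (contracted_hessian R (\<lambda>x. pd L R' x - pd L R x))" for L
    by (rule van_contracted_hessian, rule van_cong[OF van_pd[OF d]]) (simp add: pd_diff diffI smooth_R smooth_R')
  have "van k (\<lambda>x. (?h' K L x - ?h K L x) * contracted_hessian R' (pd L R') x
       + ?h K L x * ((contracted_hessian R' (pd L R') x - contracted_hessian R (pd L R') x) + contracted_hessian R (\<lambda>x. pd L R' x - pd L R x) x))" for K L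
    by (intro van_add van_mult_smooth[OF smooth_inv] van_mult_smooth'[OF van_inv_diff[OF d]] dL
        van_contracted_hessian_diff d smooth_contracted_hessian' smooth_on_pd smooth_R')
  then have 1: "van k (\<lambda>x. ?h' K L x * contracted_hessian R' (pd L R') x - ?h K L x * contracted_hessian R (pd L R) x)" for K L
    by (rule van_cong) (simp add: contracted_hessian_diff smooth_intros smooth_R' algebra_simps)
  have "van k (\<lambda>x. 1 / 2 * (\<Sum>K\<in>UNIV. \<Sum>L\<in>UNIV.
      (?h' K L x * contracted_hessian R' (pd L R') x - ?h K L x * contracted_hessian R (pd L R) x) * pd K F x) - (contracted_hessian R' F x - contracted_hessian R F x))"
    by (intro van_diff[OF _ van_contracted_hessian_diff[OF d F]] van_mult_smooth[OF smooth_on_const] van_sum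
        van_mult_smooth'[OF 1] smooth_on_pd F)
  then show ?thesis
    by (rule van_cong)
      (simp add: laplacian_hessian[OF open_U smooth_R] laplacian_hessian[OF open_U smooth_R']
        left_diff_distrib sum_subtractf diff_divide_distrib)
qed

text \<open>With L and L' the two Laplacians, the difference of the next powers is (L' - L) on the
  m-th power by L', of order h, plus L on the previous difference, which loses one order.\<close>

lemma van_laplacian_power_diff:
  assumes d: "van (Suc (Suc h)) (\<lambda>x. R' x - R x)" and u: "smooth_on U u"
  shows "m \<le> Suc h \<Longrightarrow>
    van (Suc h - m) (\<lambda>x. (laplacian (hessian R') ^^ m) u x - (laplacian (hessian R) ^^ m) u x)"
proof (induction m)
  case 0
  then show ?case by (simp only: funpow_0 id_apply diff_self van_zero)
next
  case (Suc m)
  let ?L = "laplacian (hessian R)" and ?L' = "laplacian (hessian R')"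
  have s: "smooth_on U ((?L ^^ m) u)" by (induction m) (auto intro: u smooth_laplacian)
  have s': "smooth_on U ((?L' ^^ m) u)" by (induction m) (auto intro: u smooth_laplacian')
  have m: "Suc h - m = Suc (h - m)" using Suc.prems by simp
  have "van (h - m) (\<lambda>x. (?L' ((?L' ^^ m) u) x - ?L ((?L' ^^ m) u) x)
      + ?L (\<lambda>x. (?L' ^^ m) u x - (?L ^^ m) u x) x)"
    using Suc.IH Suc.prems m
    by (intro van_add van_laplacian van_mono[OF van_laplacian_diff[OF d s']]) auto
  then have "van (h - m) (\<lambda>x. ?L' ((?L' ^^ m) u) x - ?L ((?L ^^ m) u) x)"
    by (rule van_cong) (simp add: laplacian_diff s s')
  then show ?case by simp
qed

text \<open>Starting from order 1, each use of \<open>van_defining_step\<close> gains one order. The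
  last is at \<open>j = h\<close>, with coefficient 2, and consumes exactly the assumed order of the
  determinant difference.\<close>

lemma van_defining_diff:
  assumes N: "CARD('k) = 2 * h + 2"
    and zero: "\<And>x. x \<in> U \<Longrightarrow> R x = 0 \<Longrightarrow> R' x = 0"
    and pos: "\<And>x. x \<in> U \<Longrightarrow> normal R' x > 0"
    and det: "van (Suc h) (\<lambda>x. det (hessian R' x) - det (hessian R x))"
  shows "van (Suc (Suc h)) (\<lambda>x. R' x - R x)"
proof -
  let ?d = "\<lambda>x. R' x - R x"
  have R': "(\<lambda>x. R x + (R' x - R x)) = R'" by simp
  have hom: "euler ?d x = 2 * ?d x" if "x \<in> U" for x
  proof -
    have "euler ?d x = euler R' x - euler R x"
      by (simp add: euler_def pd_diff diffI[OF _ that] smooth_R smooth_R' right_diff_distrib sum_subtractf)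
    then show ?thesis using euler_R[OF that] euler_R'[OF that] by simp
  qed
  have pos': "1 + normal ?d x > 0" if x: "x \<in> U" for x
  proof -
    have "normal ?d x = normal R' x - normal R x"
      by (simp add: normal_def pd_diff diffI[OF _ x] smooth_R smooth_R' right_diff_distrib sum_subtractf)
    then show ?thesis using pos[OF x] normal_R[OF x] by simp
  qed
  have "j \<le> Suc h \<Longrightarrow> van (Suc j) ?d" for j
  proof (induction j)
    case 0
    show ?case using zero by (auto intro!: smooth_intros smooth_R')
  next
    case (Suc j)
    show ?case
    proof (rule van_defining_step[OF N])
      show "van (Suc j) (\<lambda>x. det (hessian (\<lambda>x. R x + ?d x) x) - det (hessian R x))"
        unfolding R' using det Suc.prems by (rule van_mono)
    qed (use Suc hom pos' nondeg in auto)
  qed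
  then show ?thesis by blast
qed

end

section \<open>Independence of the defining function\<close>

text \<open>By Euler's identity the gradient is the Hessian applied to \<open>x\<close>; if it
  vanished, nondegeneracy would give \<open>x = 0\<close>.\<close>

lemma gradient_nonzero:
  fixes F :: "real^'k::finite \<Rightarrow> real"
  assumes "open U" "smooth_on U F" "\<And>x. x \<in> U \<Longrightarrow> euler F x = 2 * F x" "x \<in> U"
    and "det (hessian F x) \<noteq> 0" "x \<noteq> 0"
  obtains I where "pd I F x \<noteq> 0"
proof -
  have "\<exists>I. pd I F x \<noteq> 0"
  proof (rule ccontr)
    assume "\<not> ?thesis"
    then have "x v* hessian F x = 0"
      using euler_pd[OF assms(1-4)]
      by (simp add: vec_eq_iff vector_matrix_mult_def hessian_def euler_def mult.commute)
    then have "(x v* hessian F x) v* matrix_inv (hessian F x) = 0" by simp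
    then show False
      using assms(5,6) by (simp add: vector_matrix_mul_assoc matrix_inv_mult)
  qed
  then show thesis using that by blast
qed

text \<open>Along the line in direction \<open>e\<close>, \<open>R\<close> is negative just before
  \<open>x\<close> and positive just after it. Hence \<open>R'\<close> is negative before and
  nonnegative after, which fixes its value at \<open>x\<close> and the sign of its slope up to a
  zero slope.\<close>

lemma sign_change:
  fixes R R' :: "real^'k::finite \<Rightarrow> real"
  assumes U: "open U" "x \<in> U" and R: "R differentiable at x" "R x = 0"
    and e: "(\<Sum>I\<in>UNIV. e $ I * pd I R x) > 0"
    and sgn: "\<And>y. y \<in> U \<Longrightarrow> R y < 0 \<longleftrightarrow> R' y < 0" and R': "R' differentiable at x"
  shows "R' x = 0" "(\<Sum>I\<in>UNIV. e $ I * pd I R' x) \<ge> 0"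
proof -
  note DR = DERIV_along_line[OF R(1), of e] and DR' = DERIV_along_line[OF R', of e]
  have line: "((\<lambda>s. x + s *\<^sub>R e) \<longlongrightarrow> x) (at 0)"
    by (auto intro!: tendsto_eq_intros)
  have inU: "\<forall>\<^sub>F s in at 0. x + s *\<^sub>R e \<in> U"
    using topological_tendstoD[OF line U] .
  have neg: "\<forall>\<^sub>F s in at_left 0. R' (x + s *\<^sub>R e) < 0"
  proof -
    obtain d where d: "d > 0" "\<And>h. 0 < h \<Longrightarrow> h < d \<Longrightarrow> R (x + (0 - h) *\<^sub>R e) < R (x + 0 *\<^sub>R e)"
      using DERIV_pos_inc_left[OF DR e] by blast
    have "\<forall>\<^sub>F s in at_left 0. s \<in> {-d<..<0}"
      by (rule eventually_at_leftI[of "-d"]) (use d in auto)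
    then have "\<forall>\<^sub>F s in at_left 0. R (x + s *\<^sub>R e) < 0"
    proof (rule eventually_mono)
      fix s assume "s \<in> {-d<..<0}"
      then show "R (x + s *\<^sub>R e) < 0" using d(2)[of "- s"] R(2) by simp
    qed
    moreover have "\<forall>\<^sub>F s in at_left 0. x + s *\<^sub>R e \<in> U"
      using inU by (simp add: eventually_at_split)
    ultimately show ?thesis by eventually_elim (use sgn in blast)
  qed
  have nonneg: "\<forall>\<^sub>F s in at_right 0. R' (x + s *\<^sub>R e) \<ge> 0"
  proof -
    obtain d where d: "d > 0" "\<And>h. 0 < h \<Longrightarrow> h < d \<Longrightarrow> R (x + 0 *\<^sub>R e) < R (x + (0 + h) *\<^sub>R e)"
      using DERIV_pos_inc_right[OF DR e] by blast
    have "\<forall>\<^sub>F s in at_right 0. s \<in> {0<..<d}"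
      by (rule eventually_at_rightI[of _ d]) (use d in auto)
    then have "\<forall>\<^sub>F s in at_right 0. R (x + s *\<^sub>R e) > 0"
      by (rule eventually_mono) (use d(2) R(2) in auto)
    moreover have "\<forall>\<^sub>F s in at_right 0. x + s *\<^sub>R e \<in> U"
      using inU by (simp add: eventually_at_split)
    ultimately show ?thesis by eventually_elim (use sgn in \<open>meson not_less order.asym\<close>)
  qed
  have lim: "((\<lambda>s. R' (x + s *\<^sub>R e)) \<longlongrightarrow> R' x) (at 0)"
    using DERIV_isCont[OF DR'] by (simp add: isCont_def)
  have "R' x \<le> 0"
    by (rule tendsto_upperbound[OF _ _ trivial_limit_at_left_real])
      (use lim neg in \<open>auto simp: filterlim_at_split elim: eventually_mono\<close>)
  moreover have "R' x \<ge> 0"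
    by (rule tendsto_lowerbound[OF _ nonneg trivial_limit_at_right_real])
      (use lim in \<open>auto simp: filterlim_at_split\<close>)
  ultimately show R'0: "R' x = 0" by simp
  show "(\<Sum>I\<in>UNIV. e $ I * pd I R' x) \<ge> 0"
  proof (rule ccontr)
    assume "\<not> ?thesis"
    then have l: "(\<Sum>I\<in>UNIV. e $ I * pd I R' x) < 0" by simp
    obtain d where d: "d > 0" "\<And>h. 0 < h \<Longrightarrow> h < d \<Longrightarrow> R' (x + 0 *\<^sub>R e) < R' (x + (0 - h) *\<^sub>R e)"
      using DERIV_neg_dec_left[OF DR' l] by blast
    have "\<forall>\<^sub>F s in at_left 0. s \<in> {-d<..<0}"
      by (rule eventually_at_leftI[of "-d"]) (use d in auto)
    from eventually_conj[OF neg this] have "\<forall>\<^sub>F s in at_left (0::real). False"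
    proof (rule eventually_mono)
      fix s assume "R' (x + s *\<^sub>R e) < 0 \<and> s \<in> {- d<..<0}"
      then show False using d(2)[of "- s"] R'0 by simp
    qed
    then show False using trivial_limit_at_left_real[of "0::real"] by (simp add: trivial_limit_def)
  qed
qed

text \<open>Since \<open>R\<close> and \<open>R'\<close> are related only through their negative
  sets, transversality and nondegeneracy are proved at \<open>x\<close> and spread to a
  neighbourhood: \<open>U1\<close> for \<open>R\<close>, then \<open>U2\<close> for
  \<open>R'\<close>. The preceding uniqueness result and the comparison of Laplacians apply on
  \<open>U2\<close>.\<close>

theorem laplacian_power_eq_on_hypersurface:
  fixes R R' :: "real^'k::finite \<Rightarrow> real"
  assumes N: "CARD('k) = 2 * h + 2" and m: "m \<le> h" and U: "open U" "x \<in> U" "x \<noteq> 0"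
    and R: "smooth_on U R" "\<And>y. y \<in> U \<Longrightarrow> euler R y = 2 * R y" "smooth_on U Q"
      "\<And>y. y \<in> U \<Longrightarrow> det (hessian R y) = - 1 + Q y * R y ^ Suc h"
    and R': "smooth_on U R'" "\<And>y. y \<in> U \<Longrightarrow> euler R' y = 2 * R' y" "smooth_on U Q'"
      "\<And>y. y \<in> U \<Longrightarrow> det (hessian R' y) = - 1 + Q' y * R' y ^ Suc h"
    and sgn: "\<And>y. y \<in> U \<Longrightarrow> R y < 0 \<longleftrightarrow> R' y < 0" and zero: "R x = 0"
    and u: "smooth_on U u"
  shows "(laplacian (hessian R) ^^ m) u x = (laplacian (hessian R') ^^ m) u x"
proof -
  \<comment> \<open>The coordinate gradient of \<open>R\<close> at \<open>x\<close>, frozen to a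
    constant vector; the derivative of \<open>R\<close> along it at \<open>x\<close> is a sum of
    squares.\<close>
  define e :: "real^'k" where "e = (\<chi> I. pd I R x)"
  let ?N = "\<lambda>y. \<Sum>I\<in>UNIV. e $ I * pd I R y" and ?N' = "\<lambda>y. \<Sum>I\<in>UNIV. e $ I * pd I R' y"
  have s: "smooth_on U ?N" "smooth_on U ?N'"
    by (intro smooth_on_sum smooth_on_mult smooth_on_const smooth_on_pd R(1) R'(1) U(1))+
  have sdet: "smooth_on U (\<lambda>y. det (hessian F y) * det (hessian F y))" if "smooth_on U F" for F :: "real^'k \<Rightarrow> real"
    using that U by (auto intro!: smooth_on_mult smooth_on_det smooth_on_pd simp: hessian_def)
  have detx: "det (hessian R x) = - 1" using R(4)[OF U(2)] zero by simp
  obtain I0 where "pd I0 R x \<noteq> 0"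
    using gradient_nonzero[OF U(1) R(1,2) U(2) _ U(3)] detx by auto
  then have ex: "?N x > 0"
    using sum_pos2[of UNIV I0 "\<lambda>I. pd I R x * pd I R x"] by (simp add: e_def less_le)
  \<comment> \<open>The square turns nondegeneracy into a positivity condition, so that
    \<open>open_smooth_pos\<close> applies.\<close>
  define U1 where "U1 = {y \<in> {y \<in> U. ?N y > 0}. det (hessian R y) * det (hessian R y) > 0}"
  have oU1: "open U1"
    unfolding U1_def by (intro open_smooth_pos U(1) s(1) smooth_on_subset[OF sdet[OF R(1)]]) blast
  have U1U: "U1 \<subseteq> U" and x1: "x \<in> U1"
    unfolding U1_def using U ex detx by auto
  interpret H: hypersurface U1 R e
    using oU1 smooth_on_subset[OF R(1) U1U] by unfold_locales (auto simp: U1_def)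
  have d: "F differentiable at y" if "smooth_on U F" "y \<in> U" for F :: "real^'k \<Rightarrow> real" and y
    using that by (rule smooth_on_differentiable)
  have zero1: "R' y = 0" if "y \<in> U1" "R y = 0" for y
  proof (rule sign_change(1)[OF U(1) _ d[OF R(1)] that(2) _ sgn d[OF R'(1)]])
    show "?N y > 0" "y \<in> U" "y \<in> U" "y \<in> U" using that(1) by (simp_all add: U1_def)
  qed
  have detx': "det (hessian R' x) = - 1" using R'(4)[OF U(2)] zero1[OF x1 zero] by simp
  have ex': "?N' x > 0"
  proof -
    have "?N' x \<ge> 0"
      by (rule sign_change(2)[OF U(1,2) d[OF R(1) U(2)] zero ex sgn d[OF R'(1) U(2)]])
    \<comment> \<open>At \<open>x\<close> the gradient of \<open>R'\<close> is
      \<open>H.normal R' x\<close> times that of \<open>R\<close>, because \<open>R'\<close>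
      vanishes where \<open>R\<close> does. A zero slope would therefore make the whole gradient of
      \<open>R'\<close> vanish.\<close>
    moreover have "?N' x \<noteq> 0"
    proof
      assume 0: "?N' x = 0"
      have "H.normal R' x = ?N' x / ?N x"
        by (simp add: H.normal_def H.nu_def sum_divide_distrib)
      then have n: "H.normal R' x = 0" using 0 by simp
      have "H.van 1 R'"
        using zero1 smooth_on_subset[OF R'(1) U1U] by (auto intro: smooth_on_pd)
      then have v: "H.van 1 (\<lambda>x. pd I R' x - pd I R x * H.normal R' x)" for I
        by (rule H.van_pd_minus_normal)
      have "pd I R' x = 0" for I
        using H.van_eq_0[OF v[of I, unfolded One_nat_def] x1 zero] n by simp
      then show False
        using gradient_nonzero[OF U(1) R'(1,2) U(2) _ U(3)] detx' by auto
    qed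
    ultimately show ?thesis by simp
  qed
  define U2 where "U2 = {y \<in> {y \<in> U1. ?N' y > 0}. det (hessian R' y) * det (hessian R' y) > 0}"
  have oU2: "open U2"
    unfolding U2_def
    by (intro open_smooth_pos oU1 smooth_on_subset[OF s(2) U1U] smooth_on_subset[OF sdet[OF R'(1)]])
      (use U1U in blast)
  have U21: "U2 \<subseteq> U1" and U2U: "U2 \<subseteq> U" and x2: "x \<in> U2"
    unfolding U2_def using U1U ex' detx' x1 by auto
  interpret two_defining_functions U2 R e R'
  proof unfold_locales
    show "open U2" by (rule oU2)
    show "smooth_on U2 R" "smooth_on U2 R'" by (rule smooth_on_subset[OF _ U2U], rule R(1) R'(1))+
    fix y assume y: "y \<in> U2"
    show "?N y > 0" "det (hessian R y) \<noteq> 0" using y U21 by (auto simp: U1_def)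
    show "euler R y = 2 * R y" "euler R' y = 2 * R' y" using y U2U by (auto intro: R(2) R'(2))
    show "det (hessian R' y) \<noteq> 0" using y by (auto simp: U2_def)
  qed
  have vR': "van 1 R'" using zero1 U21 smooth_R' by (auto intro: smooth_on_pd)
  have sm: "smooth_on U2 Q" "smooth_on U2 Q'" "smooth_on U2 u"
    by (rule smooth_on_subset[OF _ U2U], rule R(3) R'(3) u)+
  \<comment> \<open>Both error terms have order h + 1 along the zero set of \<open>R\<close>, as
    \<open>R'\<close> vanishes there as well.\<close>
  have "van (Suc h) (\<lambda>y. Q' y * R' y ^ Suc h - Q y * R y ^ Suc h)"
    using van_power[OF vR', of "Suc h"] van_power[OF van_R, of "Suc h"]
    by (intro van_diff van_mult_smooth sm) simp_all
  then have det: "van (Suc h) (\<lambda>y. det (hessian R' y) - det (hessian R y))"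
    by (rule van_cong) (use R(4) R'(4) U2U in auto)
  have "van (Suc (Suc h)) (\<lambda>y. R' y - R y)"
  proof (rule van_defining_diff[OF N _ _ det])
    fix y assume y: "y \<in> U2"
    show "R' y = 0" if "R y = 0" using zero1 that y U21 by blast
    have "normal R' y = ?N' y / ?N y"
      by (simp add: normal_def nu_def sum_divide_distrib)
    then show "normal R' y > 0" using transversal[OF y] y by (simp add: U2_def)
  qed
  \<comment> \<open>The hypothesis \<open>m \<le> h\<close> leaves order at least 1, that is,
    vanishing on the hypersurface.\<close>
  from van_laplacian_power_diff[OF this sm(3), of m] m
  have "van (Suc (h - m)) (\<lambda>y. (laplacian (hessian R') ^^ m) u y - (laplacian (hessian R) ^^ m) u y)"
    by (simp add: Suc_diff_le)
  from van_eq_0[OF this x2 zero] show ?thesis by simp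
qed

section \<open>Affine charts\<close>

text \<open>The projection of the ambient space to the manifold in affine coordinates; it recovers
  \<open>snd c p\<close> from \<open>ambient_point c t p\<close> for nonzero
  \<open>t\<close>.\<close>

definition base :: "real^('n::finite option option) \<Rightarrow> real^'n option" where
  "base \<xi> = (\<chi> i. \<xi> $ Some i / \<xi> $ None)"

definition ambient_cone :: "('a, 'n::finite option) chart \<Rightarrow> (real^('n option option)) set" where
  "ambient_cone c = {\<xi>. \<xi> $ None > 0 \<and> base \<xi> \<in> snd c ` fst c}"

lemma continuous_on_base: "continuous_on {\<xi>. \<xi> $ None > 0} base"
  unfolding base_def[abs_def] by (intro continuous_on_vec_lambda continuous_intros) auto

lemma open_ambient_cone:
  assumes "open (snd c ` fst c)"
  shows "open (ambient_cone c)"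
proof -
  have "open {\<xi>::real^('n::finite option option). \<xi> $ None > 0}"
    by (intro open_Collect_less continuous_intros)
  then have "open ({\<xi>. \<xi> $ None > 0} \<inter> base -` (snd c ` fst c))"
    by (rule continuous_open_preimage[OF continuous_on_base _ assms])
  moreover have "ambient_cone c = {\<xi>. \<xi> $ None > 0} \<inter> base -` (snd c ` fst c)"
    by (auto simp: ambient_cone_def)
  ultimately show ?thesis by simp
qed

lemma ambient_fun_base: "ambient_fun w f c \<xi> = f c (cinv c (base \<xi>)) * (\<xi> $ None) powr w"
  by (simp add: ambient_fun_def base_def)

lemma smooth_ambient_fun:
  assumes "open (snd c ` fst c)" "smooth_on (snd c ` fst c) (f c \<circ> cinv c)"
  shows "smooth_on (ambient_cone c) (ambient_fun w f c)"
proof -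
  note o = open_ambient_cone[OF assms(1)]
  have "smooth_on (ambient_cone c) (\<lambda>\<xi>. (f c \<circ> cinv c) (base \<xi>))"
  proof (rule smooth_on_compose[OF o assms(1) _ _ assms(2)])
    show "base \<xi> \<in> snd c ` fst c" if "\<xi> \<in> ambient_cone c" for \<xi>
      using that by (simp add: ambient_cone_def)
    show "smooth_on (ambient_cone c) (\<lambda>\<xi>. base \<xi> $ i)" for i
      unfolding base_def vec_lambda_beta
      by (intro smooth_on_divide o smooth_on_component) (simp add: ambient_cone_def)
  qed
  then have "smooth_on (ambient_cone c) (\<lambda>\<xi>. (f c \<circ> cinv c) (base \<xi>) * (\<xi> $ None) powr w)"
    by (intro smooth_on_mult smooth_on_powr o smooth_on_component) (simp_all add: ambient_cone_def)
  then show ?thesis by (simp add: ambient_fun_base[abs_def])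
qed

lemma euler_ambient_fun:
  assumes "open (snd c ` fst c)" "smooth_on (snd c ` fst c) (f c \<circ> cinv c)" "\<xi> \<in> ambient_cone c"
  shows "euler (ambient_fun w f c) \<xi> = w * ambient_fun w f c \<xi>"
proof (rule euler_homogeneous)
  show "ambient_fun w f c differentiable at \<xi>"
    by (rule smooth_on_differentiable[OF smooth_ambient_fun[where f = f and c = c, OF assms(1,2)] assms(3)])
  fix t :: real assume "t > 0"
  then have "base (t *\<^sub>R \<xi>) = base \<xi>" by (simp add: base_def vec_eq_iff)
  then show "ambient_fun w f c (t *\<^sub>R \<xi>) = t powr w * ambient_fun w f c \<xi>"
    using \<open>t > 0\<close> assms(3) by (simp add: ambient_fun_base powr_mult ambient_cone_def)
qed

lemma ambient_cone_point:
  assumes "\<xi> \<in> ambient_cone c"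
  shows "cinv c (base \<xi>) \<in> fst c" "\<xi> = ambient_point c (\<xi> $ None) (cinv c (base \<xi>))"
proof -
  show "cinv c (base \<xi>) \<in> fst c" using assms by (simp add: ambient_cone_def inv_into_into)
  have "snd c (cinv c (base \<xi>)) = base \<xi>" using assms by (simp add: ambient_cone_def f_inv_into_f)
  then show "\<xi> = ambient_point c (\<xi> $ None) (cinv c (base \<xi>))"
    using assms by (auto simp: ambient_point_def vec_eq_iff base_def ambient_cone_def split: option.split)
qed

lemma base_ambient_point: "t \<noteq> 0 \<Longrightarrow> base (ambient_point c t p) = snd c p"
  by (simp add: base_def ambient_point_def vec_eq_iff)

section \<open>Signs of defining densities and comparison in an affine chart\<close>

lemma defining_density_neg:
  assumes "defining_density N \<Omega> \<rho>" "c \<in> atl N" "p \<in> fst c" "fst c \<subseteq> pts N"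
  shows "\<rho> c p < 0 \<longleftrightarrow> p \<in> \<Omega>"
proof -
  obtain \<tau> r where \<tau>: "proj_scale N (pts N) \<tau>" and r: "defining_function N \<Omega> r"
    and eq: "\<And>c p. c \<in> atl N \<Longrightarrow> p \<in> fst c \<Longrightarrow> r p = \<tau> c p powr (- 2) * \<rho> c p"
    using assms(1) unfolding defining_density_def by blast
  have "\<tau> c p > 0"
    using \<tau> assms(2-4) unfolding proj_scale_def by blast
  then have "\<tau> c p powr (- 2) > 0" by simp
  then have "\<rho> c p < 0 \<longleftrightarrow> r p < 0" using eq[OF assms(2,3)] by (simp add: mult_less_0_iff)
  also have "\<dots> \<longleftrightarrow> p \<in> \<Omega>" using r assms(3,4) by (auto simp: defining_function_def)
  finally show ?thesis .
qed

text \<open>A boundary point lies outside \<Omega>, so \<rho> is not negative there; it lies in the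
  closure of \<Omega>, so by continuity \<rho> is not positive either.\<close>

lemma defining_density_eq_0:
  fixes N :: "('a::{t2_space, second_countable_topology}, 'n::finite) proj_mfd"
  assumes \<rho>: "defining_density N \<Omega> \<rho>" and c: "c \<in> atl N" "is_chart (pts N) c" and p: "p \<in> bdry N \<Omega> \<inter> fst c"
    and \<Omega>: "\<Omega> \<subseteq> pts N"
  shows "\<rho> c p = 0"
proof -
  have sub: "fst c \<subseteq> pts N" using c(2) by (auto simp: is_chart_def dest: openin_imp_subset)
  have "\<not> \<rho> c p < 0"
    using defining_density_neg[OF \<rho> c(1) _ sub] p by (auto simp: bdry_def)
  moreover have "\<not> \<rho> c p > 0"
  proof
    assume pos: "\<rho> c p > 0"
    have "smooth_on (snd c ` fst c) (\<rho> c \<circ> cinv c)"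
      using \<rho> c(1) sub
      by (auto simp: defining_density_def proj_density_def volume_power_section_def Int_absorb2)
    then have "continuous_on (snd c ` fst c) (\<rho> c \<circ> cinv c)" by (rule smooth_on_continuous)
    moreover have hom: "homeomorphism (fst c) (snd c ` fst c) (snd c) (cinv c)"
      using c(2) by (simp add: is_chart_def)
    then have "continuous_on (fst c) (snd c)" by (simp add: homeomorphism_def)
    ultimately have "continuous_on (fst c) ((\<rho> c \<circ> cinv c) \<circ> snd c)"
      by (intro continuous_on_compose[of "fst c" "snd c" "\<rho> c \<circ> cinv c"])
    then have "continuous_on (fst c) (\<rho> c)"
      by (rule continuous_on_eq) (use hom in \<open>simp add: homeomorphism_def\<close>)
    then have "openin (top_of_set (fst c)) (fst c \<inter> \<rho> c -` {0<..})"
      by (rule continuous_openin_preimage_gen) simp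
    then have "openin (top_of_set (pts N)) (fst c \<inter> \<rho> c -` {0<..})"
      using c(2) openin_trans by (auto simp: is_chart_def)
    then obtain V where V: "open V" "fst c \<inter> \<rho> c -` {0<..} = pts N \<inter> V"
      by (auto simp: openin_open)
    have "p \<in> V" "p \<in> closure \<Omega>" using p pos V(2) by (auto simp: bdry_def)
    then obtain y where "y \<in> \<Omega>" "y \<in> V"
      using V(1) by (metis closure_iff_nhds_not_empty disjoint_iff order_refl)
    then have "y \<in> fst c" "\<rho> c y > 0" "y \<in> \<Omega>" using V(2) \<Omega> by auto
    then show False using defining_density_neg[OF \<rho> c(1) _ sub] by fastforce
  qed
  ultimately show ?thesis by simp
qed

text \<open>Over one affine chart both densities are functions of degree 2 on the open cone above
  it, negative over the same set \<Omega>. The comparison theorem is applied at the point with fibre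
  coordinate 1.\<close>

lemma ambient_laplacian_power_eq:
  fixes N :: "('a::{t2_space, second_countable_topology}, 'n::finite) proj_mfd"
  assumes "oriented_projective_manifold N" and n: "even CARD('n)" "m \<le> CARD('n) div 2" and \<Omega>: "\<Omega> \<subseteq> pts N"
    and \<rho>: "fefferman_defining_density N \<Omega> \<rho>" and \<rho>': "fefferman_defining_density N \<Omega> \<rho>'"
    and f: "proj_density N (pts N) w f" and c: "affine_chart N c" and p: "p \<in> bdry N \<Omega> \<inter> fst c"
  shows "ambient_laplacian_power \<rho> m w f c p = ambient_laplacian_power \<rho>' m w f c p"
proof -
  have cN: "c \<in> atl N" using c by (simp add: affine_chart_def)
  then have chart: "is_chart (pts N) c"
    using assms(1) by (simp add: oriented_projective_manifold_def oriented_atlas_def)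
  have sub: "fst c \<subseteq> pts N" using chart by (auto simp: is_chart_def dest: openin_imp_subset)
  have op: "open (snd c ` fst c)" using chart by (simp add: is_chart_def)
  have sm: "smooth_on (snd c ` fst c) (F c \<circ> cinv c)" if "proj_density N (pts N) v F" for F v
    using that cN sub by (auto simp: proj_density_def volume_power_section_def Int_absorb2)
  have dd: "defining_density N \<Omega> \<rho>" "defining_density N \<Omega> \<rho>'"
    using \<rho> \<rho>' by (auto simp: fefferman_defining_density_def)
  have pd2: "proj_density N (pts N) 2 \<rho>" "proj_density N (pts N) 2 \<rho>'"
    using dd by (auto simp: defining_density_def)
  let ?h = "CARD('n) div 2" and ?A = "\<lambda>F. ambient_fun 2 F c"
  have det: "\<exists>Q. smooth_on (ambient_cone c) Q \<and>
      (\<forall>\<xi>\<in>ambient_cone c. det (hessian (?A F) \<xi>) = - 1 + Q \<xi> * ?A F \<xi> ^ Suc ?h)"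
    if F: "fefferman_defining_density N \<Omega> F" for F
  proof -
    obtain \<O> where \<O>: "proj_density N (pts N) (- (real CARD('n) + 2)) \<O>"
      and J: "\<And>p t. p \<in> fst c \<Longrightarrow> t > 0 \<Longrightarrow>
        calJ F c (ambient_point c t p) = - 1 + \<O> c p * F c p ^ (?h + 1)"
      using F c unfolding fefferman_defining_density_def by blast
    \<comment> \<open>The power of \<rho> must be rewritten in its ambient function, which carries
      t^2 for each factor \<rho>; the compensating t^(-2(h + 1)) is moved into the coefficient.
      Since n + 2 = 2(h + 1), \<open>Q\<close> is the ambient function of the density
      \<open>\<O>\<close> of weight - n - 2.\<close>
    define Q where "Q \<xi> = ambient_fun 0 \<O> c \<xi> * ((\<xi> $ None) powr (- 2)) ^ Suc ?h" for \<xi>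
    have "smooth_on (ambient_cone c) Q"
      unfolding Q_def[abs_def]
      by (intro smooth_on_mult smooth_on_power smooth_on_powr smooth_on_component
          smooth_ambient_fun sm[OF \<O>] op open_ambient_cone) (simp add: ambient_cone_def)
    moreover have "det (hessian (?A F) \<xi>) = - 1 + Q \<xi> * ?A F \<xi> ^ Suc ?h" if \<xi>: "\<xi> \<in> ambient_cone c" for \<xi>
    proof -
      have t: "\<xi> $ None > 0" using \<xi> by (simp add: ambient_cone_def)
      have "det (hessian (?A F) \<xi>) = calJ F c (ambient_point c (\<xi> $ None) (cinv c (base \<xi>)))"
        unfolding calJ_def ambient_cone_point(2)[OF \<xi>, symmetric] ..
      also have "\<dots> = - 1 + \<O> c (cinv c (base \<xi>)) * F c (cinv c (base \<xi>)) ^ (?h + 1)"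
        by (rule J[OF ambient_cone_point(1)[OF \<xi>] t])
      also have "F c (cinv c (base \<xi>)) = (\<xi> $ None) powr (- 2) * ?A F \<xi>"
        using t by (simp add: ambient_fun_base powr_minus field_simps)
      also have "\<O> c (cinv c (base \<xi>)) = ambient_fun 0 \<O> c \<xi>"
        using t by (simp add: ambient_fun_base)
      finally show ?thesis
        by (simp only: Q_def power_mult_distrib Suc_eq_plus1 mult.assoc)
    qed
    ultimately show ?thesis by blast
  qed
  obtain Q where Q: "smooth_on (ambient_cone c) Q"
    "\<And>\<xi>. \<xi> \<in> ambient_cone c \<Longrightarrow> det (hessian (?A \<rho>) \<xi>) = - 1 + Q \<xi> * ?A \<rho> \<xi> ^ Suc ?h"
    using det[OF \<rho>] by blast
  obtain Q' where Q': "smooth_on (ambient_cone c) Q'"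
    "\<And>\<xi>. \<xi> \<in> ambient_cone c \<Longrightarrow> det (hessian (?A \<rho>') \<xi>) = - 1 + Q' \<xi> * ?A \<rho>' \<xi> ^ Suc ?h"
    using det[OF \<rho>'] by blast
  let ?x = "ambient_point c 1 p"
  have px: "p \<in> fst c" using p by simp
  have x0: "?x $ None = 1" by (simp add: ambient_point_def)
  have x: "?x \<in> ambient_cone c" "?x \<noteq> 0"
    using px x0 by (auto simp: ambient_cone_def base_ambient_point)
  have "cinv c (snd c p) = p"
    using chart px by (simp add: is_chart_def homeomorphism_def)
  then have zero: "?A \<rho> ?x = 0"
    using defining_density_eq_0[OF dd(1) cN chart p \<Omega>] by (simp add: ambient_fun_base base_ambient_point)
  have sgn: "?A \<rho> \<xi> < 0 \<longleftrightarrow> ?A \<rho>' \<xi> < 0" if \<xi>: "\<xi> \<in> ambient_cone c" for \<xi>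
  proof -
    have "?A F \<xi> < 0 \<longleftrightarrow> cinv c (base \<xi>) \<in> \<Omega>" if "defining_density N \<Omega> F" for F
      using defining_density_neg[OF that cN ambient_cone_point(1)[OF \<xi>] sub] \<xi>
      by (simp add: ambient_fun_base mult_less_0_iff ambient_cone_def)
    then show ?thesis using dd by simp
  qed
  have "(laplacian (hessian (?A \<rho>)) ^^ m) (ambient_fun w f c) ?x
      = (laplacian (hessian (?A \<rho>')) ^^ m) (ambient_fun w f c) ?x"
  proof (rule laplacian_power_eq_on_hypersurface[where Q = Q and Q' = Q', OF _ n(2) open_ambient_cone[OF op] x(1,2)])
    show "CARD('n option option) = 2 * ?h + 2" using n(1) by (simp add: card_UNIV_option)
  qed (assumption | rule zero sgn Q Q' smooth_ambient_fun euler_ambient_fun op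
      sm[OF pd2(1)] sm[OF pd2(2)] sm[OF f])+
  then show ?thesis by (simp add: ambient_laplacian_power_def ambient_metric_def)
qed

theorem proposition3p3:
  fixes N :: "('a::{t2_space, second_countable_topology}, 'n::finite) proj_mfd"
    and \<Omega> :: "'a set"
    and \<rho> \<rho>' :: "('a, 'n option) components"
    and m :: nat
  assumes "oriented_projective_manifold N"
    and "locally_flat N"
    and "even CARD('n)"
    and "relatively_compact_domain N \<Omega>"
    and "smooth_strictly_convex_boundary N \<Omega>"
    and "1 \<le> m" and "m \<le> CARD('n) div 2"
    and "fefferman_defining_density N \<Omega> \<rho>"
    and "fefferman_defining_density N \<Omega> \<rho>'"
  shows "\<forall>f. conf_density N \<Omega> (real m - real CARD('n) / 2) f \<longrightarrow>
           GJMS N \<Omega> \<rho> m f = GJMS N \<Omega> \<rho>' m f"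
proof (intro allI impI ext)
  fix f b p
  let ?w = "real m - real CARD('n) / 2" and ?w' = "- real m - real CARD('n) / 2"
  have \<Omega>: "\<Omega> \<subseteq> pts N"
    using assms(4) by (auto simp: relatively_compact_domain_def dest: openin_imp_subset)
  have "restrict_to_bdry N \<Omega> ?w' (ambient_laplacian_power \<rho> m ?w f') b p
      = restrict_to_bdry N \<Omega> ?w' (ambient_laplacian_power \<rho>' m ?w f') b p"
    if b: "b \<in> bdry_atlas N \<Omega>" "p \<in> fst b" and f': "smooth_extension N \<Omega> ?w f f'" for f'
  proof -
    have p: "p \<in> bdry N \<Omega>"
      using b by (auto simp: bdry_atlas_def is_chart_def dest: openin_imp_subset)
    have "ambient_laplacian_power \<rho> m ?w f' c p = ambient_laplacian_power \<rho>' m ?w f' c p"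
      if "affine_chart N c" "p \<in> fst c" for c
      using f' p that
      by (intro ambient_laplacian_power_eq[OF assms(1,3,7) \<Omega> assms(8,9)]) (auto simp: smooth_extension_def)
    \<comment> \<open>The predicate under \<open>SOME\<close> reads the density only at
      \<open>p\<close> and in affine charts around it, where the two densities agree.\<close>
    then show ?thesis
      unfolding restrict_to_bdry_def by (intro arg_cong[where f = Eps] ext) metis
  qed
  \<comment> \<open>The admissible extensions \<open>f'\<close> are the same for \<rho> and \<rho>',
    so the two choices are made from equal predicates.\<close>
  then have "(\<lambda>y. \<exists>f'. smooth_extension N \<Omega> ?w f f' \<and>
        y = restrict_to_bdry N \<Omega> ?w' (ambient_laplacian_power \<rho> m ?w f') b p)
    = (\<lambda>y. \<exists>f'. smooth_extension N \<Omega> ?w f f' \<and>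
        y = restrict_to_bdry N \<Omega> ?w' (ambient_laplacian_power \<rho>' m ?w f') b p)"
    if "b \<in> bdry_atlas N \<Omega>" "p \<in> fst b"
    using that by (intro ext) metis
  then show "GJMS N \<Omega> \<rho> m f b p = GJMS N \<Omega> \<rho>' m f b p"
    unfolding GJMS_def Let_def by auto
qed

end
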